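(* Let $H$ be a numerical monoid. If $H \ne \mathbb N$, then the automorphism group $\operatorname{Aut}(\mathcal P_{\mathrm{fin},0}(H))$ is trivial. If $H = \mathbb N$, then the only non-trivial automorphism of $\mathcal P_{\mathrm{fin},0}(\mathbb N)$ is the reversion map $X \mapsto \max(X) - X$.
   Context: $\mathbb N$ is the additive monoid of non-negative integers. A numerical monoid is a submonoid $H$ of $(\mathbb N,+)$ (so $0 \in H$) such that $\mathbb N \setminus H$ is finite. $\mathcal P_{\mathrm{fin},0}(H)$ is the monoid of all finite subsets of $H$ containing $0$, with operation the sumset $X+Y := \{x+y : x \in X,\ y \in Y\}$ and identity $\{0\}$. $\operatorname{Aut}$ denotes the group of (monoid) automorphisms. For a finite non-empty $X \subseteq \mathbb N$, $\max(X) - X := \{\max(X) - x : x \in X\}$. *)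

theory Defs
  imports "HOL-Algebra.Bij" "HOL-Algebra.Elementary_Groups" "HOL-Library.Set_Algebras"
begin

definition nat_add_monoid :: "nat monoid" where
  "nat_add_monoid = \<lparr>carrier = UNIV, monoid.mult = (+), one = 0\<rparr>"

definition numerical_monoid :: "nat set \<Rightarrow> bool" where
  "numerical_monoid H \<longleftrightarrow> submonoid H nat_add_monoid \<and> finite (UNIV - H)"

text \<open>The operation is the sumset, written \<open>X + Y\<close> in \<^theory>\<open>HOL-Library.Set_Algebras\<close>.\<close>

definition Pfin0 :: "nat set \<Rightarrow> nat set monoid" where
  "Pfin0 H = \<lparr>carrier = {X. finite X \<and> X \<subseteq> H \<and> 0 \<in> X}, monoid.mult = (+), one = {0}\<rparr>"

text \<open>Subtraction on \<^typ>\<open>nat\<close> does not truncate here, since \<open>x \<le> Max X\<close> for all \<open>x \<in> X\<close>.\<close>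

definition reversion :: "nat set \<Rightarrow> nat set" where
  "reversion X = {Max X - x | x. x \<in> X}"

lemma monoid_Pfin0:
  assumes "numerical_monoid H"
  shows "monoid (Pfin0 H)"
proof (rule monoidI)
  have cl: "x + y \<in> H" if "x \<in> H" "y \<in> H" for x y
    using assms that submonoid.m_closed[of H nat_add_monoid x y]
    by (simp add: numerical_monoid_def nat_add_monoid_def)
  have "0 \<in> H"
    using assms submonoid.one_closed[of H nat_add_monoid]
    by (simp add: numerical_monoid_def nat_add_monoid_def)
  then show "\<one>\<^bsub>Pfin0 H\<^esub> \<in> carrier (Pfin0 H)"
    by (simp add: Pfin0_def)
  show "X \<otimes>\<^bsub>Pfin0 H\<^esub> Y \<in> carrier (Pfin0 H)"
    if "X \<in> carrier (Pfin0 H)" "Y \<in> carrier (Pfin0 H)" for X Y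
  proof -
    have "finite (X + Y)"
      using that by (simp add: Pfin0_def finite_set_plus)
    moreover have "X + Y \<subseteq> H"
      using that cl by (fastforce simp: Pfin0_def set_plus_def)
    moreover have "0 \<in> X + Y"
      using that by (force simp: Pfin0_def set_plus_def)
    ultimately show ?thesis by (simp add: Pfin0_def)
  qed
qed (simp_all add: Pfin0_def add.assoc flip: set_zero)

text \<open>
  The library's \<^const>\<open>auto\<close> and \<^const>\<open>hom\<close> require preservation of the product only. For a
  bijection this already gives preservation of the identity, so the elements of
  \<^term>\<open>auto G\<close> are the monoid automorphisms of \<open>G\<close> (as extensional functions).
\<close>

lemma (in monoid) auto_one:
  assumes "f \<in> auto G"
  shows "f \<one> = \<one>"
proof -
  have im: "f ` carrier G = carrier G"
    and hom: "\<And>x y. \<lbrakk>x \<in> carrier G; y \<in> carrier G\<rbrakk> \<Longrightarrow> f (x \<otimes> y) = f x \<otimes> f y"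
    using assms by (auto simp: auto_def Bij_def hom_def bij_betw_def)
  have f1: "f \<one> \<in> carrier G" using im by blast
  obtain e where e: "e \<in> carrier G" "f e = \<one>" using im one_closed by (metis imageE)
  have "f \<one> = f \<one> \<otimes> f e" using e f1 by simp
  also have "\<dots> = f e" using hom[of \<one> e] e by simp
  finally show ?thesis using e by simp
qed

end

theory Submission
  imports Defs "HOL-Library.Product_Plus"
begin

text \<open>
  Two facts about an automorphism \<open>f\<close> are easy. It preserves maxima, since every \<open>A\<close> with maximum
  \<open>a\<close> satisfies \<open>A + Z = {0, a} + Z\<close> for some \<open>Z\<close>, so that \<open>max f(A)\<close> depends on \<open>a\<close> only, and an
  additive bijection of \<open>H\<close> is the identity. And it fixes every \<open>{0, a}\<close>, because
  \<open>k A + A = k A + {0, a}\<close> for large \<open>k\<close>, by a zero-sum argument modulo \<open>a\<close>.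

  The sets fixed so far are all symmetric under reversion, so they cannot tell the two ends of a set
  apart. The decisive objects are sets that contain everything away from their two ends: for
  \<open>P \<subseteq> H\<close> and \<open>Q\<close> cofinite, \<open>two_ended (P, Q) n\<close> looks like \<open>P\<close> near \<open>0\<close> and, read downwards, like
  \<open>Q\<close> near \<open>n\<close>. For large \<open>n\<close> such sets are recognised by how they react to adding \<open>{0, x}\<close>,
  \<open>{0, y}\<close> and \<open>{0, x + y}\<close>, and all of these are fixed. Hence \<open>f\<close> maps them to sets of the same
  kind, and induces an automorphism \<open>F\<close> of the product of two monoids, that of the cofinite subsets
  of \<open>H\<close> and that of the cofinite subsets of \<open>\<nat>\<close>, each with \<open>0\<close> and under sumset
  (\<open>image_two_ended\<close>, \<open>F_add\<close>, \<open>F_bij\<close>).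

  In the first of these monoids \<open>H\<close> is a zero, and the sets \<open>H - {p}\<close> with \<open>p \<noteq> 0\<close> come next to it:
  adding anything to them gives \<open>H - {p}\<close> or \<open>H\<close>. A set that completes \<open>H - {p}\<close> or \<open>H - {q}\<close> also
  completes \<open>H - {p + q}\<close>, and this links all of them; likewise in the second monoid. It follows
  that \<open>F\<close> either respects or exchanges the two axes of the product (\<open>axis_dichotomy\<close>).

  If \<open>F\<close> respects the axes, it fixes every \<open>(P, \<nat>)\<close>, by induction on the number of elements of \<open>H\<close>
  missing in \<open>P\<close> (\<open>F_fix_axis\<close>). For an arbitrary \<open>A\<close> and \<open>y \<notin> A\<close>, the sumset of \<open>A\<close> with the
  set of \<open>0\<close> and all elements of \<open>H\<close> above \<open>y\<close> is such a \<open>P\<close>, and \<open>y\<close> is still missing in it.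
  Therefore \<open>f(A) \<subseteq> A\<close> for all \<open>A\<close>, and \<open>f\<close> is the identity
  (\<open>identity_of_axis\<close>). If \<open>F\<close> exchanges the axes, then \<open>H = \<nat>\<close>, since divisibility
  in \<open>H\<close> would have to be the usual order (\<open>axis_swap_imp_UNIV\<close>); composing \<open>f\<close> with the
  reversion leads back to the first case.
\<close>

section \<open>Numerical monoids and cofinite sets of naturals\<close>

lemma numerical_monoid_iff:
  "numerical_monoid K \<longleftrightarrow> 0 \<in> K \<and> (\<forall>x\<in>K. \<forall>y\<in>K. x + y \<in> K) \<and> finite (UNIV - K)"
  by (auto simp: numerical_monoid_def nat_add_monoid_def submonoid_def)

lemma numerical_monoidD:
  assumes "numerical_monoid K"
  shows "0 \<in> K" "\<And>x y. x \<in> K \<Longrightarrow> y \<in> K \<Longrightarrow> x + y \<in> K" "finite (UNIV - K)"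
  using assms by (auto simp: numerical_monoid_iff)

lemma numerical_monoid_UNIV: "numerical_monoid UNIV"
  by (simp add: numerical_monoid_iff)

section \<open>Sumsets of cofinite subsets of a numerical monoid\<close>

definition cofin0 :: "nat set \<Rightarrow> nat set set" where
  "cofin0 K = {P. 0 \<in> P \<and> P \<subseteq> K \<and> finite (UNIV - P)}"

text \<open>
  The monoid of cofinite sets has no identity, and these submonoids replace it: each
  cofinite set is left unchanged by all tails that start late enough.
\<close>

definition tail :: "nat set \<Rightarrow> nat \<Rightarrow> nat set" where
  "tail K c = insert 0 (K \<inter> {c<..})"

lemma finite_compl_bounded:
  assumes "finite (UNIV - (P :: nat set))"
  obtains c where "{c<..} \<subseteq> P"
proof -
  from assms obtain c where "UNIV - P \<subseteq> {..c}"
    using finite_nat_iff_bounded_le by blast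
  then have "{c<..} \<subseteq> P" by (auto simp: subset_iff)
  then show ?thesis by (rule that)
qed

lemma finite_compl_greaterThan: "{c<..} \<subseteq> (P :: nat set) \<Longrightarrow> finite (UNIV - P)"
  by (rule finite_subset[of _ "{..c}"]) (auto simp: subset_iff, meson linorder_not_le)

lemma self_in_cofin0: "numerical_monoid K \<Longrightarrow> K \<in> cofin0 K"
  by (simp add: cofin0_def numerical_monoid_iff)

lemma plus_in_cofin0:
  assumes "numerical_monoid K" "P \<in> cofin0 K" "X \<subseteq> K" "0 \<in> X"
  shows "P + X \<in> cofin0 K"
proof -
  have "P \<subseteq> P + X" using assms(4) by (metis add.commute set_zero_plus2)
  then have "finite (UNIV - (P + X))" "0 \<in> P + X"
    using assms(2) finite_subset[of "UNIV - (P + X)" "UNIV - P"] by (auto simp: cofin0_def)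
  moreover have "P + X \<subseteq> K"
    using assms numerical_monoidD(2)[OF assms(1)] by (fastforce simp: cofin0_def set_plus_def)
  ultimately show ?thesis by (simp add: cofin0_def)
qed

lemma absorb:
  assumes "numerical_monoid K" "X \<subseteq> K" "0 \<in> X"
  shows "X + K = K" "K + X = K"
proof -
  have "K \<subseteq> X + K" using assms(3) by (rule set_zero_plus2)
  moreover have "X + K \<subseteq> K"
    using assms numerical_monoidD(2)[OF assms(1)] by (fastforce simp: set_plus_def)
  ultimately show "X + K = K" by simp
  then show "K + X = K" by (simp add: add.commute)
qed

lemma absorb_cofin0:
  "numerical_monoid K \<Longrightarrow> X \<in> cofin0 K \<Longrightarrow> X + K = K"
  "numerical_monoid K \<Longrightarrow> X \<in> cofin0 K \<Longrightarrow> K + X = K"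
  by (auto simp: absorb cofin0_def)

lemma tail_in_cofin0: "numerical_monoid K \<Longrightarrow> tail K c \<in> cofin0 K"
proof -
  assume K: "numerical_monoid K"
  have "UNIV - tail K c \<subseteq> (UNIV - K) \<union> {..c}" by (auto simp: tail_def)
  then have "finite (UNIV - tail K c)"
    using numerical_monoidD(3)[OF K] by (meson finite_UnI finite_atMost finite_subset)
  then show ?thesis
    using numerical_monoidD(1)[OF K] by (auto simp: cofin0_def tail_def)
qed

lemma plus_tail:
  assumes "numerical_monoid K" "P \<subseteq> K" "K \<inter> {c<..} \<subseteq> P"
  shows "P + tail K c = P"
proof
  show "P \<subseteq> P + tail K c"
    by (metis add.commute insertI1 set_zero_plus2 tail_def)
  have "x + y \<in> P" if "x \<in> P" "y \<in> K" "c < y" for x y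
  proof -
    have "x + y \<in> K" using assms that numerical_monoidD(2) by blast
    then show ?thesis using assms(3) that by auto
  qed
  then show "P + tail K c \<subseteq> P"
    by (auto simp: set_plus_def tail_def)
qed

lemma cofin0_plus_tail_exists:
  assumes "numerical_monoid K" "P \<in> cofin0 K"
  obtains c where "P + tail K c = P"
  using finite_compl_bounded[of P] plus_tail[of K P] assms
  by (metis (no_types, lifting) cofin0_def inf.coboundedI2 mem_Collect_eq)

lemma punctured_in_cofin0:
  assumes "numerical_monoid K" "p \<noteq> 0"
  shows "K - {p} \<in> cofin0 K"
proof -
  have "UNIV - (K - {p}) \<subseteq> insert p (UNIV - K)" by auto
  then have "finite (UNIV - (K - {p}))"
    using numerical_monoidD(3)[OF assms(1)] by (meson finite_insert finite_subset)
  then show ?thesis using assms numerical_monoidD(1) by (auto simp: cofin0_def)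
qed

lemma punctured_plus_cases:
  assumes "numerical_monoid K" "X \<subseteq> K" "0 \<in> X" "p \<noteq> 0"
  shows "(K - {p}) + X = K - {p} \<or> (K - {p}) + X = K"
proof -
  have "K - {p} \<subseteq> (K - {p}) + X" by (metis add.commute assms(3) set_zero_plus2)
  moreover have "(K - {p}) + X \<subseteq> K + X" by (simp add: set_plus_mono2)
  ultimately show ?thesis using absorb(2)[OF assms(1-3)] by blast
qed

text \<open>
  In terms of divisibility in \<open>K\<close>, the right-hand side says that \<open>X\<close> contains a nonzero divisor of \<open>p\<close>.
\<close>

lemma punctured_plus_eq_iff:
  assumes "numerical_monoid K" "X \<subseteq> K" "0 \<in> X" "p \<in> K" "p \<noteq> 0"
  shows "(K - {p}) + X = K \<longleftrightarrow> (\<exists>x\<in>X. x \<noteq> 0 \<and> x \<le> p \<and> p - x \<in> K)"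
proof -
  have "(K - {p}) + X = K \<longleftrightarrow> p \<in> (K - {p}) + X"
    using punctured_plus_cases[OF assms(1,2,3,5)] assms(4) by auto
  also have "\<dots> \<longleftrightarrow> (\<exists>x\<in>X. x \<noteq> 0 \<and> x \<le> p \<and> p - x \<in> K)"
  proof
    assume "p \<in> (K - {p}) + X"
    then obtain k x where "p = k + x" "k \<in> K - {p}" "x \<in> X" by (rule set_plus_elim)
    then show "\<exists>x\<in>X. x \<noteq> 0 \<and> x \<le> p \<and> p - x \<in> K" by (intro bexI[of _ x]) auto
  next
    assume "\<exists>x\<in>X. x \<noteq> 0 \<and> x \<le> p \<and> p - x \<in> K"
    then obtain x where x: "x \<in> X" "x \<noteq> 0" "x \<le> p" "p - x \<in> K" by blast
    then have "p - x \<in> K - {p}" by auto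
    from set_plus_intro[OF this x(1)] x(3) show "p \<in> (K - {p}) + X" by simp
  qed
  finally show ?thesis .
qed

text \<open>
  A divisor of \<open>p\<close> also divides \<open>p + q\<close>.
\<close>

lemma punctured_plus_eq_add:
  assumes K: "numerical_monoid K" and X: "X \<subseteq> K" "0 \<in> X"
    and p: "p \<in> K" "p \<noteq> 0" and q: "q \<in> K" and eq: "(K - {p}) + X = K"
  shows "(K - {p + q}) + X = K"
proof -
  from eq obtain x where x: "x \<in> X" "x \<noteq> 0" "x \<le> p" "p - x \<in> K"
    using punctured_plus_eq_iff[OF K X p] by blast
  then have "p + q - x \<in> K" using numerical_monoidD(2)[OF K x(4) q] by simp
  then show ?thesis
    using x p q numerical_monoidD(2)[OF K] by (subst punctured_plus_eq_iff[OF K X]) auto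
qed

text \<open>
  Take \<open>p\<close> to be the least missing element: the tail above \<open>p\<close> then fills all gaps but this one.
  So every proper cofinite set becomes a punctured monoid by adding another cofinite set.
\<close>

lemma cofin0_plus_tail_eq_punctured:
  assumes K: "numerical_monoid K" and P: "P \<in> cofin0 K" and ne: "P \<noteq> K"
  obtains p where "p \<in> K" "p \<noteq> 0" "P + tail K p = K - {p}"
proof -
  define p where "p = (LEAST p. p \<in> K - P)"
  have "\<exists>p. p \<in> K - P" using P ne by (auto simp: cofin0_def)
  then have p: "p \<in> K" "p \<notin> P" unfolding p_def by (metis (mono_tags, lifting) DiffE LeastI_ex)+
  have min: "x \<in> P" if "x \<in> K" "x < p" for x
    using that not_less_Least[of x "\<lambda>p. p \<in> K - P"] by (auto simp: p_def)
  have p0: "p \<noteq> 0" using p P by (metis (no_types, lifting) cofin0_def mem_Collect_eq)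
  have PK: "P \<subseteq> K" "0 \<in> P" using P by (auto simp: cofin0_def)
  have "P + tail K p = K - {p}"
  proof (intro equalityI subsetI)
    fix x assume "x \<in> P + tail K p"
    then obtain a t where "x = a + t" "a \<in> P" "t \<in> tail K p" by (rule set_plus_elim)
    then show "x \<in> K - {p}"
      using PK p(2) numerical_monoidD(2)[OF K, of a t] by (auto simp: tail_def)
  next
    fix x assume x: "x \<in> K - {p}"
    show "x \<in> P + tail K p"
    proof (cases "x < p")
      case True
      then have "x + 0 \<in> P + tail K p" using x min by (intro set_plus_intro) (auto simp: tail_def)
      then show ?thesis by simp
    next
      case False
      then have "0 + x \<in> P + tail K p" using x PK by (intro set_plus_intro) (auto simp: tail_def)
      then show ?thesis by simp
    qed
  qed
  then show ?thesis using that p p0 by blast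
qed

section \<open>Isomorphisms between products of two monoids of cofinite sets\<close>

locale bijective_pair_hom =
  fixes K1 K2 L1 L2 :: "nat set" and F :: "nat set \<times> nat set \<Rightarrow> nat set \<times> nat set"
  assumes num: "numerical_monoid K1" "numerical_monoid K2"
    "numerical_monoid L1" "numerical_monoid L2"
    and bij: "bij_betw F (cofin0 K1 \<times> cofin0 K2) (cofin0 L1 \<times> cofin0 L2)"
    and add: "\<And>\<alpha> \<beta>. \<alpha> \<in> cofin0 K1 \<times> cofin0 K2 \<Longrightarrow> \<beta> \<in> cofin0 K1 \<times> cofin0 K2 \<Longrightarrow>
      F (\<alpha> + \<beta>) = F \<alpha> + F \<beta>"
begin

lemma F_inj: "\<alpha> \<in> cofin0 K1 \<times> cofin0 K2 \<Longrightarrow> \<beta> \<in> cofin0 K1 \<times> cofin0 K2 \<Longrightarrow> F \<alpha> = F \<beta> \<Longrightarrow> \<alpha> = \<beta>"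
  using bij by (metis bij_betw_def inj_onD)

lemma F_in: "\<alpha> \<in> cofin0 K1 \<times> cofin0 K2 \<Longrightarrow> F \<alpha> \<in> cofin0 L1 \<times> cofin0 L2"
  using bij by (metis bij_betwE)

lemma F_surj:
  assumes "\<beta> \<in> cofin0 L1 \<times> cofin0 L2"
  obtains P Q where "P \<in> cofin0 K1" "Q \<in> cofin0 K2" "F (P, Q) = \<beta>"
proof -
  have "\<beta> \<in> F ` (cofin0 K1 \<times> cofin0 K2)" using assms bij by (simp add: bij_betw_def)
  then show ?thesis using that by blast
qed

text \<open>
  The pair of full monoids is the only absorbing element.
\<close>

lemma F_zero: "F (K1, K2) = (L1, L2)"
proof -
  obtain P Q where w: "P \<in> cofin0 K1" "Q \<in> cofin0 K2" "F (P, Q) = (L1, L2)"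
    using F_surj num self_in_cofin0 by (metis SigmaI)
  have "F (K1, K2) = F ((K1, K2) + (P, Q))"
    using w num by (simp add: plus_prod_def absorb_cofin0)
  also have "\<dots> = F (K1, K2) + (L1, L2)"
    using w num self_in_cofin0 by (subst add) auto
  also have "\<dots> = (L1, L2)"
    using F_in[of "(K1, K2)"] num self_in_cofin0
    by (auto simp: plus_prod_def absorb_cofin0 mem_Times_iff)
  finally show ?thesis .
qed

text \<open>
  Let \<open>(P, Q)\<close> be the preimage of the punctured element. Adding a late tail in one coordinate and
  the full monoid in the other turns \<open>(P, Q)\<close> into \<open>(P, K2)\<close>, whose image is a multiple of the
  punctured element: either the zero or the punctured element itself. If \<open>P\<close> is not full,
  injectivity leaves only the second option, and forces \<open>Q = K2\<close>.
\<close>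

lemma punctured_in_axis:
  assumes p: "p \<in> L1" "p \<noteq> 0"
  shows "(\<exists>P\<in>cofin0 K1. F (P, K2) = (L1 - {p}, L2)) \<or>
         (\<exists>Q\<in>cofin0 K2. F (K1, Q) = (L1 - {p}, L2))"
proof -
  obtain P Q where w: "P \<in> cofin0 K1" "Q \<in> cofin0 K2" "F (P, Q) = (L1 - {p}, L2)"
    using F_surj num self_in_cofin0 punctured_in_cofin0 p by (metis SigmaI)
  show ?thesis
  proof (cases "P = K1")
    case True
    then show ?thesis using w by blast
  next
    case False
    obtain c where c: "P + tail K1 c = P"
      using cofin0_plus_tail_exists num w by blast
    have tin: "(tail K1 c, K2) \<in> cofin0 K1 \<times> cofin0 K2"
      using num by (auto simp: tail_in_cofin0 self_in_cofin0)
    have "F (P, K2) = F ((P, Q) + (tail K1 c, K2))"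
      using w num c by (simp add: plus_prod_def absorb_cofin0)
    also have "\<dots> = (L1 - {p}, L2) + F (tail K1 c, K2)"
      using w tin by (subst add) auto
    finally have "F (P, K2) = (L1 - {p}, L2) \<or> F (P, K2) = (L1, L2)"
      using F_in[OF tin] num punctured_plus_cases[of L1 "fst (F (tail K1 c, K2))" p] p
      by (auto simp: plus_prod_def absorb_cofin0 mem_Times_iff) (auto simp: cofin0_def)
    moreover have "F (P, K2) \<noteq> (L1, L2)"
      using F_inj[of "(P, K2)" "(K1, K2)"] F_zero False w num self_in_cofin0 by auto
    ultimately show ?thesis using w by blast
  qed
qed

text \<open>
  Suppose that the punctures at \<open>p\<close> and \<open>q\<close> come from different axes. The puncture at \<open>p + q\<close> comes
  from one of them. An element of that axis that acts trivially on its preimage annihilates the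
  other axis, hence fills the puncture at \<open>p\<close> or at \<open>q\<close>, and so also the one at \<open>p + q\<close>, on
  which its image acts trivially.
\<close>

lemma punctured_axis_uniform:
  assumes p: "p \<in> L1" "p \<noteq> 0" and q: "q \<in> L1" "q \<noteq> 0"
    and P: "P \<in> cofin0 K1" "F (P, K2) = (L1 - {p}, L2)"
    and Q: "Q \<in> cofin0 K2" "F (K1, Q) = (L1 - {q}, L2)"
  shows False
proof -
  have r: "p + q \<in> L1" "p + q \<noteq> 0" using p q num numerical_monoidD(2) by auto
  have ne: "L1 - {p + q} \<noteq> L1" using r by auto
  \<comment> \<open>An element that completes the puncture at p or at q also completes the one at p + q.\<close>
  have kill: "fst (F \<alpha>) + (L1 - {p + q}) = L1"
    if "\<alpha> \<in> cofin0 K1 \<times> cofin0 K2" "s = p \<or> s = q" "fst (F \<alpha>) + (L1 - {s}) = L1" for \<alpha> s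
  proof -
    have "fst (F \<alpha>) \<subseteq> L1" "0 \<in> fst (F \<alpha>)"
      using F_in[OF that(1)] by (auto simp: mem_Times_iff cofin0_def)
    then show ?thesis
      using punctured_plus_eq_add[OF num(3), of "fst (F \<alpha>)" p q]
        punctured_plus_eq_add[OF num(3), of "fst (F \<alpha>)" q p] that p q
      by (auto simp: add.commute)
  qed
  from punctured_in_axis[OF r] show False
  proof
    assume "\<exists>P'\<in>cofin0 K1. F (P', K2) = (L1 - {p + q}, L2)"
    then obtain P' where P': "P' \<in> cofin0 K1" "F (P', K2) = (L1 - {p + q}, L2)" by blast
    obtain c where c: "P' + tail K1 c = P'" using cofin0_plus_tail_exists num P' by blast
    have tin: "(tail K1 c, K2) \<in> cofin0 K1 \<times> cofin0 K2"
      using num by (auto simp: tail_in_cofin0 self_in_cofin0)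
    have "F (tail K1 c, K2) + F (K1, Q) = F ((tail K1 c, K2) + (K1, Q))"
      using tin Q num by (subst add) (auto simp: self_in_cofin0)
    also have "\<dots> = (L1, L2)"
      using tin Q num F_zero by (simp add: plus_prod_def absorb_cofin0)
    finally have 1: "fst (F (tail K1 c, K2)) + (L1 - {q}) = L1"
      by (metis Q(2) fst_add fst_conv)
    have "F (tail K1 c, K2) + F (P', K2) = F ((tail K1 c, K2) + (P', K2))"
      using tin P' num by (subst add) (auto simp: self_in_cofin0)
    also have "\<dots> = F (P', K2)"
      using c P' num by (simp add: plus_prod_def absorb_cofin0 self_in_cofin0 add.commute)
    finally have 2: "fst (F (tail K1 c, K2)) + (L1 - {p + q}) = L1 - {p + q}"
      by (metis P'(2) fst_add fst_conv)
    show False using kill[OF tin _ 1] 2 ne by simp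
  next
    assume "\<exists>Q'\<in>cofin0 K2. F (K1, Q') = (L1 - {p + q}, L2)"
    then obtain Q' where Q': "Q' \<in> cofin0 K2" "F (K1, Q') = (L1 - {p + q}, L2)" by blast
    obtain c where c: "Q' + tail K2 c = Q'" using cofin0_plus_tail_exists num Q' by blast
    have tin: "(K1, tail K2 c) \<in> cofin0 K1 \<times> cofin0 K2"
      using num by (auto simp: tail_in_cofin0 self_in_cofin0)
    have "F (K1, tail K2 c) + F (P, K2) = F ((K1, tail K2 c) + (P, K2))"
      using tin P num by (subst add) (auto simp: self_in_cofin0)
    also have "\<dots> = (L1, L2)"
      using tin P num F_zero by (simp add: plus_prod_def absorb_cofin0)
    finally have 1: "fst (F (K1, tail K2 c)) + (L1 - {p}) = L1"
      by (metis P(2) fst_add fst_conv)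
    have "F (K1, tail K2 c) + F (K1, Q') = F ((K1, tail K2 c) + (K1, Q'))"
      using tin Q' num by (subst add) (auto simp: self_in_cofin0)
    also have "\<dots> = F (K1, Q')"
      using c Q' num by (simp add: plus_prod_def absorb_cofin0 self_in_cofin0 add.commute)
    finally have 2: "fst (F (K1, tail K2 c)) + (L1 - {p + q}) = L1 - {p + q}"
      by (metis Q'(2) fst_add fst_conv)
    show False using kill[OF tin _ 1] 2 ne by simp
  qed
qed

text \<open>
  If the image of \<open>(K1, Q)\<close> were not full in the first coordinate, one of its multiples would be
  a punctured element. This comes from the first axis by assumption, but also from a multiple of
  \<open>(K1, Q)\<close>, which lies on the second.
\<close>

lemma fst_image_full:
  assumes all: "\<And>p. p \<in> L1 \<Longrightarrow> p \<noteq> 0 \<Longrightarrow> \<exists>P\<in>cofin0 K1. F (P, K2) = (L1 - {p}, L2)"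
    and Q: "Q \<in> cofin0 K2"
  shows "fst (F (K1, Q)) = L1"
proof (rule ccontr)
  assume ne: "fst (F (K1, Q)) \<noteq> L1"
  have KQ: "(K1, Q) \<in> cofin0 K1 \<times> cofin0 K2" using Q num self_in_cofin0 by auto
  obtain p where p: "p \<in> L1" "p \<noteq> 0" "fst (F (K1, Q)) + tail L1 p = L1 - {p}"
    using cofin0_plus_tail_eq_punctured[OF num(3) _ ne] F_in[OF KQ] by (auto simp: mem_Times_iff)
  obtain P where P: "P \<in> cofin0 K1" "F (P, K2) = (L1 - {p}, L2)" using all p by blast
  obtain P1 Q1 where w: "P1 \<in> cofin0 K1" "Q1 \<in> cofin0 K2" "F (P1, Q1) = (tail L1 p, L2)"
    using F_surj num self_in_cofin0 tail_in_cofin0 by (metis SigmaI)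
  have "F ((K1, Q) + (P1, Q1)) = F (K1, Q) + (tail L1 p, L2)"
    using w KQ by (subst add) auto
  also have "\<dots> = F (P, K2)"
    using p P F_in[OF KQ] num by (auto simp: plus_prod_def absorb_cofin0 mem_Times_iff)
  finally have "F (K1, Q + Q1) = F (P, K2)"
    using w num by (simp add: plus_prod_def absorb_cofin0)
  moreover have "Q + Q1 \<in> cofin0 K2"
    using Q w num by (intro plus_in_cofin0) (auto simp: cofin0_def)
  ultimately have "P = K1"
    using F_inj[of "(K1, Q + Q1)" "(P, K2)"] P num self_in_cofin0 by auto
  then show False using P F_zero p by auto
qed

end

lemma bijective_pair_hom_swap_left:
  assumes "bijective_pair_hom K1 K2 L1 L2 F"
  shows "bijective_pair_hom K1 K2 L2 L1 (prod.swap \<circ> F)"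
proof -
  interpret bijective_pair_hom K1 K2 L1 L2 F by (rule assms)
  show ?thesis
  proof
    show "bij_betw (prod.swap \<circ> F) (cofin0 K1 \<times> cofin0 K2) (cofin0 L2 \<times> cofin0 L1)"
      by (rule bij_betw_trans[OF bij])
        (auto simp: bij_betw_def inj_on_def image_iff)
    show "(prod.swap \<circ> F) (\<alpha> + \<beta>) = (prod.swap \<circ> F) \<alpha> + (prod.swap \<circ> F) \<beta>"
      if "\<alpha> \<in> cofin0 K1 \<times> cofin0 K2" "\<beta> \<in> cofin0 K1 \<times> cofin0 K2" for \<alpha> \<beta>
      by (simp only: o_apply add[OF that]) (simp add: plus_prod_def)
  qed (simp_all add: num)
qed

lemma bijective_pair_hom_swap_right:
  assumes "bijective_pair_hom K1 K2 L1 L2 F"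
  shows "bijective_pair_hom K2 K1 L1 L2 (F \<circ> prod.swap)"
proof -
  interpret bijective_pair_hom K1 K2 L1 L2 F by (rule assms)
  show ?thesis
  proof
    show "bij_betw (F \<circ> prod.swap) (cofin0 K2 \<times> cofin0 K1) (cofin0 L1 \<times> cofin0 L2)"
      by (rule bij_betw_trans[OF _ bij])
        (auto simp: bij_betw_def inj_on_def image_iff)
    show "(F \<circ> prod.swap) (\<alpha> + \<beta>) = (F \<circ> prod.swap) \<alpha> + (F \<circ> prod.swap) \<beta>"
      if "\<alpha> \<in> cofin0 K2 \<times> cofin0 K1" "\<beta> \<in> cofin0 K2 \<times> cofin0 K1" for \<alpha> \<beta>
      using that add[of "prod.swap \<alpha>" "prod.swap \<beta>"] by (auto simp: plus_prod_def)
  qed (simp_all add: num)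
qed

context bijective_pair_hom
begin

lemma fst_dichotomy:
  "(\<forall>Q\<in>cofin0 K2. fst (F (K1, Q)) = L1) \<or> (\<forall>P\<in>cofin0 K1. fst (F (P, K2)) = L1)"
proof (cases "\<forall>p\<in>L1. p \<noteq> 0 \<longrightarrow> (\<exists>P\<in>cofin0 K1. F (P, K2) = (L1 - {p}, L2))")
  case True
  then show ?thesis using fst_image_full by blast
next
  case False
  then have "\<exists>Q\<in>cofin0 K2. F (K1, Q) = (L1 - {p}, L2)" if "p \<in> L1" "p \<noteq> 0" for p
    using punctured_in_axis punctured_axis_uniform that by metis
  then show ?thesis
    using bijective_pair_hom.fst_image_full
      [OF bijective_pair_hom_swap_right[OF bijective_pair_hom_axioms]] by simp
qed

text \<open>
  Each of the two coordinates of \<open>F\<close> is full on one of the two axes. They are not both full on the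
  second axis, since \<open>F\<close> would be constant there.
\<close>

lemma axis_dichotomy:
  "(\<forall>P\<in>cofin0 K1. snd (F (P, K2)) = L2) \<or> (\<forall>P\<in>cofin0 K1. fst (F (P, K2)) = L1)"
proof (rule ccontr)
  assume contra: "\<not> ?thesis"
  interpret sw: bijective_pair_hom K1 K2 L2 L1 "prod.swap \<circ> F"
    by (rule bijective_pair_hom_swap_left[OF bijective_pair_hom_axioms])
  have fQ: "F (K1, Q) = (L1, L2)" if "Q \<in> cofin0 K2" for Q
    using contra fst_dichotomy sw.fst_dichotomy that by (auto simp: prod_eq_iff)
  obtain c where "{c<..} \<subseteq> K2" using finite_compl_bounded num numerical_monoidD(3) by metis
  then have q: "Suc c \<in> K2" by auto
  have "(K1, K2 - {Suc c}) = (K1, K2)"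
    using F_inj[of "(K1, K2 - {Suc c})" "(K1, K2)"] fQ num self_in_cofin0 punctured_in_cofin0
    by auto
  then show False using q by auto
qed

end

section \<open>Iterated sumsets\<close>

fun nsum :: "nat \<Rightarrow> nat set \<Rightarrow> nat set" where
  "nsum 0 A = {0}"
| "nsum (Suc k) A = A + nsum k A"

lemma nsum_list: "x \<in> nsum k A \<longleftrightarrow> (\<exists>xs. length xs = k \<and> set xs \<subseteq> A \<and> sum_list xs = x)"
proof (induction k arbitrary: x)
  case (Suc k)
  show ?case
  proof
    assume "x \<in> nsum (Suc k) A"
    then obtain a y where a: "x = a + y" "a \<in> A" "y \<in> nsum k A" by (auto elim: set_plus_elim)
    then obtain xs where "length xs = k" "set xs \<subseteq> A" "sum_list xs = y" using Suc by blast
    with a show "\<exists>xs. length xs = Suc k \<and> set xs \<subseteq> A \<and> sum_list xs = x"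
      by (intro exI[of _ "a # xs"]) auto
  next
    assume "\<exists>xs. length xs = Suc k \<and> set xs \<subseteq> A \<and> sum_list xs = x"
    then obtain a xs where "length xs = k" "a \<in> A" "set xs \<subseteq> A" "a + sum_list xs = x"
      by (auto simp: length_Suc_conv)
    then show "x \<in> nsum (Suc k) A" using Suc by auto
  qed
qed auto

text \<open>
  Two of the prefix sums agree modulo \<open>a\<close>, by the pigeonhole principle.
\<close>

lemma block_sum_dvd:
  fixes xs :: "nat list"
  assumes "0 < a" "a \<le> length xs"
  obtains us vs ws where "xs = us @ vs @ ws" "vs \<noteq> []" "a dvd sum_list vs"
proof -
  let ?f = "\<lambda>i. sum_list (take i xs) mod a"
  have "?f ` {..length xs} \<subseteq> {..<a}" using assms by auto
  then have "card (?f ` {..length xs}) \<le> a" by (metis card_lessThan card_mono finite_lessThan)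
  then have "\<not> inj_on ?f {..length xs}" using card_image[of ?f "{..length xs}"] assms by auto
  then obtain i j where ij: "i < j" "j \<le> length xs" "?f i = ?f j"
    by (auto simp: inj_on_def) (metis linorder_neqE_nat)
  define vs where "vs = drop i (take j xs)"
  have tk: "take j xs = take i xs @ vs"
    using ij by (simp add: vs_def) (metis append_take_drop_id min.absorb1 less_imp_le take_take)
  have "sum_list (take j xs) = sum_list (take i xs) + sum_list vs" by (simp add: tk)
  then have "a dvd sum_list vs" using ij(3)
    by (metis add_diff_cancel_left' mod_eq_dvd_iff_nat le_add1)
  moreover have "xs = take i xs @ vs @ drop j xs" using tk by (metis append.assoc append_take_drop_id)
  moreover have "vs \<noteq> []" using ij by (simp add: vs_def)
  ultimately show ?thesis using that by blast
qed

text \<open>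
  A sum of at least \<open>a\<close> elements of \<open>A\<close> contains a block whose sum is a multiple of \<open>a\<close>. Rewritten
  with the summands \<open>a\<close> and \<open>0\<close>, it provides the summand from \<open>{0, a}\<close>.
\<close>

lemma nsum_stable:
  assumes "A \<subseteq> {..a}" "0 \<in> A" "a \<in> A" "0 < a" "a \<le> Suc k"
  shows "nsum k A + A = nsum k A + {0, a}"
proof
  show "nsum k A + {0, a} \<subseteq> nsum k A + A" using assms by (intro set_plus_mono2) auto
  show "nsum k A + A \<subseteq> nsum k A + {0, a}"
  proof
    fix x assume "x \<in> nsum k A + A"
    then have "x \<in> nsum (Suc k) A" by (simp add: add.commute)
    then obtain xs where xs: "length xs = Suc k" "set xs \<subseteq> A" "sum_list xs = x"
      using nsum_list by blast
    then obtain us vs ws where b: "xs = us @ vs @ ws" "vs \<noteq> []" "a dvd sum_list vs"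
      using block_sum_dvd[of a xs thesis] assms by metis
    then obtain t where t: "sum_list vs = a * t" by auto
    have "sum_list vs \<le> a * length vs"
      using sum_list_mono[of vs "\<lambda>x. x" "\<lambda>_. a"] xs b assms
      by (auto simp: sum_list_triv mult.commute)
    then have tl: "t \<le> length vs" using t assms by simp
    \<comment> \<open>A block whose sum is divisible by a can be replaced by copies of a and of 0.\<close>
    define rs where "rs = replicate t a @ replicate (length vs - t) 0"
    have rs: "length rs = length vs" "sum_list rs = sum_list vs" "set rs \<subseteq> {0, a}"
      using tl t by (auto simp: rs_def sum_list_replicate set_replicate_conv_if)
    then obtain r rs' where r: "rs = r # rs'" using b by (cases rs) auto
    have "length (us @ rs' @ ws) = k" "set (us @ rs' @ ws) \<subseteq> A"
      using rs r xs b assms by auto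
    then have "sum_list (us @ rs' @ ws) \<in> nsum k A" unfolding nsum_list by blast
    moreover have "x = sum_list (us @ rs' @ ws) + r" using rs r xs b by simp
    moreover have "r \<in> {0, a}" using rs r by auto
    ultimately show "x \<in> nsum k A + {0, a}" by blast
  qed
qed

lemma dvd_nsum: "(\<And>y. y \<in> A \<Longrightarrow> a dvd y) \<Longrightarrow> x \<in> nsum k A \<Longrightarrow> a dvd x"
  by (induction k arbitrary: x) (auto elim!: set_plus_elim)

section \<open>Automorphisms preserve maxima and two-element sets\<close>

lemma Max_set_plus:
  fixes X Y :: "nat set"
  assumes "finite X" "finite Y" "X \<noteq> {}" "Y \<noteq> {}"
  shows "Max (X + Y) = Max X + Max Y"
proof (rule Max_eqI)
  show "finite (X + Y)" using assms by (simp add: finite_set_plus)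
  show "Max X + Max Y \<in> X + Y" using assms by (intro set_plus_intro Max_in)
  show "y \<le> Max X + Max Y" if "y \<in> X + Y" for y
    using that assms by (auto elim!: set_plus_elim intro!: add_mono)
qed

definition fin0 :: "nat set \<Rightarrow> nat set set" where
  "fin0 H = {X. finite X \<and> X \<subseteq> H \<and> 0 \<in> X}"

lemma fin0D: "X \<in> fin0 H \<Longrightarrow> finite X" "X \<in> fin0 H \<Longrightarrow> X \<subseteq> H" "X \<in> fin0 H \<Longrightarrow> 0 \<in> X"
  "X \<in> fin0 H \<Longrightarrow> X \<noteq> {}" "X \<in> fin0 H \<Longrightarrow> Max X \<in> X" "X \<in> fin0 H \<Longrightarrow> X \<subseteq> {..Max X}"
  "X \<in> fin0 H \<Longrightarrow> Max X \<in> H"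
  by (auto simp: fin0_def subset_iff intro: Max_in)

lemma plus_in_fin0:
  assumes "numerical_monoid H" "X \<in> fin0 H" "Y \<in> fin0 H"
  shows "X + Y \<in> fin0 H"
proof -
  have "0 + 0 \<in> X + Y" using assms by (intro set_plus_intro fin0D)
  moreover have "X + Y \<subseteq> H"
    using assms numerical_monoidD(2)[OF assms(1)] by (fastforce simp: fin0_def set_plus_def)
  ultimately show ?thesis using assms by (auto simp: fin0_def finite_set_plus)
qed

lemma pair_in_fin0: "numerical_monoid H \<Longrightarrow> h \<in> H \<Longrightarrow> {0, h} \<in> fin0 H"
  by (auto simp: fin0_def numerical_monoid_iff)

lemma nsum_in_fin0: "numerical_monoid H \<Longrightarrow> X \<in> fin0 H \<Longrightarrow> nsum k X \<in> fin0 H"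
  by (induction k) (simp add: fin0_def numerical_monoid_iff, simp add: plus_in_fin0)

lemma plus_initial_segment:
  assumes "numerical_monoid H" "{c<..} \<subseteq> H" "A \<in> fin0 H" "Max A = a"
  shows "A + (H \<inter> {..c + a + 1}) = H \<inter> {..c + 2 * a + 1}"
proof (intro equalityI subsetI)
  fix y assume "y \<in> A + (H \<inter> {..c + a + 1})"
  then obtain u v where "y = u + v" "u \<in> A" "v \<in> H \<inter> {..c + a + 1}" by (rule set_plus_elim)
  then show "y \<in> H \<inter> {..c + 2 * a + 1}"
    using fin0D(2,6)[OF assms(3)] assms(4) numerical_monoidD(2)[OF assms(1), of u v]
    by (auto simp: subset_iff)
next
  fix y assume y: "y \<in> H \<inter> {..c + 2 * a + 1}"
  show "y \<in> A + (H \<inter> {..c + a + 1})"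
  proof (cases "y \<le> c + a + 1")
    case True
    then have "0 + y \<in> A + (H \<inter> {..c + a + 1})" using y fin0D(3)[OF assms(3)] by (intro set_plus_intro) auto
    then show ?thesis by simp
  next
    case False
    then have "y - a \<in> H \<inter> {..c + a + 1}" using y assms(2) by auto
    then have "a + (y - a) \<in> A + (H \<inter> {..c + a + 1})"
      using fin0D(5)[OF assms(3)] assms(4) by (intro set_plus_intro) auto
    then show ?thesis using False by simp
  qed
qed

locale pfin0_automorphism =
  fixes H :: "nat set" and f :: "nat set \<Rightarrow> nat set"
  assumes num: "numerical_monoid H"
    and f_bij: "bij_betw f (fin0 H) (fin0 H)"
    and f_add: "\<And>X Y. X \<in> fin0 H \<Longrightarrow> Y \<in> fin0 H \<Longrightarrow> f (X + Y) = f X + f Y"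
begin

lemma f_in: "X \<in> fin0 H \<Longrightarrow> f X \<in> fin0 H"
  using f_bij by (metis bij_betwE)

lemma f_inj: "X \<in> fin0 H \<Longrightarrow> Y \<in> fin0 H \<Longrightarrow> f X = f Y \<Longrightarrow> X = Y"
  using f_bij by (metis bij_betw_def inj_onD)

lemma f_surj:
  assumes "Y \<in> fin0 H" obtains X where "X \<in> fin0 H" "f X = Y"
  using assms f_bij by (metis bij_betw_def imageE)

lemma zero_H: "0 \<in> H" and add_H: "\<And>x y. x \<in> H \<Longrightarrow> y \<in> H \<Longrightarrow> x + y \<in> H"
  using numerical_monoidD[OF num] by auto

lemma conductor: obtains c where "{c<..} \<subseteq> H"
  using finite_compl_bounded numerical_monoidD(3)[OF num] by metis

lemma inverse_aut: "pfin0_automorphism H (inv_into (fin0 H) f)"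
proof
  have inv: "inv_into (fin0 H) f X \<in> fin0 H" "f (inv_into (fin0 H) f X) = X" if "X \<in> fin0 H" for X
    using that f_bij by (auto simp: bij_betw_def inv_into_into f_inv_into_f)
  show "inv_into (fin0 H) f (X + Y) = inv_into (fin0 H) f X + inv_into (fin0 H) f Y"
    if "X \<in> fin0 H" "Y \<in> fin0 H" for X Y
    using that f_inj[of "inv_into (fin0 H) f (X + Y)" "inv_into (fin0 H) f X + inv_into (fin0 H) f Y"]
    by (simp add: inv plus_in_fin0 num f_add)
qed (simp_all add: num f_bij bij_betw_inv_into)

text \<open>
  The sets \<open>A\<close> and \<open>B\<close> become equal when a long initial segment of \<open>H\<close> is added to both.
\<close>

lemma Max_image_cong:
  assumes "A \<in> fin0 H" "B \<in> fin0 H" "Max A = Max B"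
  shows "Max (f A) = Max (f B)"
proof -
  obtain c where c: "{c<..} \<subseteq> H" by (rule conductor)
  define Z where "Z = H \<inter> {..c + Max A + 1}"
  have Z: "Z \<in> fin0 H" using zero_H by (auto simp: Z_def fin0_def)
  have "A + Z = B + Z"
    unfolding Z_def using plus_initial_segment[OF num c] assms by metis
  then have "f A + f Z = f B + f Z" using f_add assms Z by metis
  then have "Max (f A) + Max (f Z) = Max (f B) + Max (f Z)"
    using f_in[THEN fin0D(1)] f_in[THEN fin0D(4)] assms Z by (simp flip: Max_set_plus)
  then show ?thesis by simp
qed

text \<open>
  By \<open>Max_image_cong\<close>, \<open>max f(A)\<close> is a function \<open>\<phi>\<close> of \<open>max A\<close>. It is additive on \<open>H\<close>, hence
  multiplication by a constant \<open>d\<close>, and it is onto \<open>H\<close>, which contains two consecutive numbers;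
  so \<open>d = 1\<close>.
\<close>

lemma Max_image:
  assumes A: "A \<in> fin0 H"
  shows "Max (f A) = Max A"
proof -
  define \<phi> where "\<phi> h = Max (f {0, h})" for h
  have \<phi>_Max: "Max (f B) = \<phi> (Max B)" if "B \<in> fin0 H" for B
    using that fin0D(7)[OF that] unfolding \<phi>_def
    by (intro Max_image_cong) (simp_all add: pair_in_fin0 num)
  have \<phi>_add: "\<phi> (x + y) = \<phi> x + \<phi> y" if "x \<in> H" "y \<in> H" for x y
  proof -
    have *: "{0, x} \<in> fin0 H" "{0, y} \<in> fin0 H" using that by (simp_all add: pair_in_fin0 num)
    have "\<phi> (x + y) = \<phi> (Max ({0, x} + {0, y}))" by (simp add: Max_set_plus)
    also have "\<dots> = Max (f ({0, x} + {0, y}))" using * by (simp add: \<phi>_Max plus_in_fin0 num)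
    also have "\<dots> = \<phi> x + \<phi> y"
      using * f_in[THEN fin0D(1)] f_in[THEN fin0D(4)] by (simp add: f_add Max_set_plus \<phi>_def)
    finally show ?thesis .
  qed
  have \<phi>_mult: "k * x \<in> H \<and> \<phi> (k * x) = k * \<phi> x" if "x \<in> H" for x k
  proof (induction k)
    case 0
    show ?case using \<phi>_add[of 0 0] zero_H by simp
  next
    case (Suc k)
    then show ?case using that \<phi>_add[of x "k * x"] add_H by simp
  qed
  have \<phi>_lin: "y * \<phi> x = x * \<phi> y" if "x \<in> H" "y \<in> H" for x y
    using \<phi>_mult[OF that(1), of y] \<phi>_mult[OF that(2), of x] by (simp add: mult.commute)
  have \<phi>_surj: "\<exists>x\<in>H. \<phi> x = h" if h: "h \<in> H" for h
  proof -
    obtain B where "B \<in> fin0 H" "f B = {0, h}" using f_surj pair_in_fin0 num h by metis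
    then show ?thesis using \<phi>_Max[of B] fin0D(7)[of B] by auto
  qed
  obtain c where c: "{c<..} \<subseteq> H" by (rule conductor)
  \<comment> \<open>Consecutive elements of H are coprime, so that x divides \<phi> x.\<close>
  define x where "x = c + 1"
  have x: "x \<in> H" "x + 1 \<in> H" "x > 0" using c by (auto simp: x_def)
  have "x dvd (x + 1) * \<phi> x" using \<phi>_lin[OF x(1,2)] by simp
  then have "x dvd \<phi> x" using dvd_add_left_iff[of x "x * \<phi> x" "\<phi> x"] by (simp add: algebra_simps)
  then obtain d where d: "\<phi> x = x * d" by auto
  have \<phi>_d: "\<phi> y = d * y" if "y \<in> H" for y
    using \<phi>_lin[OF x(1) that] x(3) by (auto simp add: d mult.left_commute mult.commute)
  have "d dvd y" if "y \<in> H" for y using \<phi>_surj[OF that] \<phi>_d by auto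
  then have "d dvd x" "d dvd x + 1" using x by blast+
  then have "d = 1" using dvd_diff_nat[of d "x + 1" x] by simp
  then show ?thesis using \<phi>_Max[OF A] \<phi>_d fin0D(7)[OF A] by simp
qed

lemma image_zero: "f {0} = {0}"
proof -
  have z: "{0} \<in> fin0 H" using zero_H by (simp add: fin0_def)
  then show ?thesis using Max_image[OF z] fin0D(3,6)[OF f_in[OF z]] by auto
qed

lemma image_nsum: "X \<in> fin0 H \<Longrightarrow> f (nsum k X) = nsum k (f X)"
  by (induction k) (simp_all add: image_zero f_add nsum_in_fin0 num)

text \<open>
  Apply the stability of iterated sumsets to the preimage \<open>A\<close> of \<open>{0, h}\<close>. Its image says that
  \<open>h {0, h} + {0, h} = h {0, h} + f {0, h}\<close>, so that all elements of \<open>f {0, h}\<close> are multiples of \<open>h\<close>;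
  they are at most \<open>h\<close>, since \<open>f\<close> preserves maxima.
\<close>

lemma image_pair:
  assumes h: "h \<in> H"
  shows "f {0, h} = {0, h}"
proof (cases "h = 0")
  case True
  then show ?thesis using image_zero by simp
next
  case False
  have p: "{0, h} \<in> fin0 H" using h num by (simp add: pair_in_fin0)
  obtain A where A: "A \<in> fin0 H" "f A = {0, h}" using f_surj p by metis
  then have "Max A = h" using Max_image[of A] by simp
  then have "nsum h A + A = nsum h A + {0, h}"
    using A fin0D[OF A(1)] False by (intro nsum_stable) auto
  then have "f (nsum h A + A) = f (nsum h A + {0, h})" by simp
  then have eq: "nsum h {0, h} + {0, h} = nsum h {0, h} + f {0, h}"
    using A p nsum_in_fin0[OF num A(1), of h] by (simp add: f_add image_nsum)
  have "y \<in> {0, h}" if y: "y \<in> f {0, h}" for y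
  proof -
    have "0 \<in> nsum h {0, h}" using nsum_in_fin0[OF num p] by (rule fin0D)
    then have "0 + y \<in> nsum h {0, h} + {0, h}" unfolding eq using y by (rule set_plus_intro)
    then have "y \<in> nsum (Suc h) {0, h}" by (simp add: add.commute)
    then have "h dvd y" by (rule dvd_nsum[rotated]) auto
    moreover have "y \<le> h" using fin0D(6)[OF f_in[OF p]] Max_image[OF p] y by auto
    ultimately show ?thesis using dvd_imp_le[of h y] by auto
  qed
  moreover have "0 \<in> f {0, h}" "h \<in> f {0, h}"
    using fin0D(3,5)[OF f_in[OF p]] Max_image[OF p] by auto
  ultimately show ?thesis by auto
qed

end

section \<open>Sets that are full away from their two ends\<close>

definition two_ended :: "nat set \<times> nat set \<Rightarrow> nat \<Rightarrow> nat set" where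
  "two_ended \<alpha> n = {x \<in> fst \<alpha>. x \<le> n \<and> n - x \<in> snd \<alpha>}"

text \<open>
  The distance from \<open>x + b\<close> to \<open>n + m\<close> is \<open>(n - x) + (m - b)\<close>; so \<open>B\<close> acts on the upper end by its
  reflection. The two ends do not interfere, because \<open>n\<close> is large.
\<close>

lemma two_ended_plus:
  assumes "{c<..} \<subseteq> P" "{c<..} \<subseteq> Q" "B \<subseteq> {..m}" "n \<ge> 2 * c + m + 1"
  shows "two_ended (P, Q) n + B = two_ended (P + B, Q + (\<lambda>b. m - b) ` B) (n + m)"
proof (intro equalityI subsetI)
  fix y assume "y \<in> two_ended (P, Q) n + B"
  then obtain x b where y: "y = x + b" "x \<in> P" "x \<le> n" "n - x \<in> Q" "b \<in> B"
    by (auto simp: two_ended_def elim!: set_plus_elim)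
  then have "b \<le> m" using assms by auto
  moreover have "(n - x) + (m - b) \<in> Q + (\<lambda>b. m - b) ` B" using y by (intro set_plus_intro) auto
  ultimately show "y \<in> two_ended (P + B, Q + (\<lambda>b. m - b) ` B) (n + m)"
    using y by (auto simp: two_ended_def)
next
  fix y assume "y \<in> two_ended (P + B, Q + (\<lambda>b. m - b) ` B) (n + m)"
  then have y: "y \<in> P + B" "y \<le> n + m" "n + m - y \<in> Q + (\<lambda>b. m - b) ` B"
    by (auto simp: two_ended_def)
  show "y \<in> two_ended (P, Q) n + B"
  proof (cases "y + c < n")
    case True
    \<comment> \<open>Far from the upper end, the condition on the distance to it holds for any decomposition of y.\<close>
    obtain x b where x: "y = x + b" "x \<in> P" "b \<in> B" using y(1) by (rule set_plus_elim)
    then have "n - x \<in> Q" using True assms(2) by auto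
    then show ?thesis using x True by (auto simp: two_ended_def)
  next
    case False
    obtain q b where q: "n + m - y = q + (m - b)" "q \<in> Q" "b \<in> B"
      using y(3) by (auto elim!: set_plus_elim)
    then have "b \<le> m" using assms by auto
    then have eq: "y + q = n + b" "b \<le> y" using q(1) y(2) False assms(4) by auto
    then have "y - b \<in> P" "y - b \<le> n" "n - (y - b) = q"
      using assms False \<open>b \<le> m\<close> q(1) by (auto intro!: subsetD[OF assms(1)])
    then have "y - b \<in> two_ended (P, Q) n" using q by (simp add: two_ended_def)
    from set_plus_intro[OF this q(3)] show ?thesis using eq by simp
  qed
qed

lemma two_ended_eventually_inject:
  assumes "{c<..} \<subseteq> snd \<alpha>" "{c<..} \<subseteq> snd \<beta>" "{c<..} \<subseteq> fst \<alpha>" "{c<..} \<subseteq> fst \<beta>"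
    and "\<forall>\<^sub>F n in sequentially. two_ended \<alpha> n = two_ended \<beta> n"
  shows "\<alpha> = \<beta>"
proof -
  obtain N where N: "two_ended \<alpha> n = two_ended \<beta> n" if "n \<ge> N" for n
    using assms(5) by (auto simp: eventually_sequentially)
  have "x \<in> fst \<alpha> \<longleftrightarrow> x \<in> fst \<beta>" for x
  proof -
    have "x \<in> two_ended \<alpha> (N + x + c + 1) \<longleftrightarrow> x \<in> two_ended \<beta> (N + x + c + 1)" by (simp add: N)
    then show ?thesis using assms by (auto simp: two_ended_def subset_iff)
  qed
  moreover have "y \<in> snd \<alpha> \<longleftrightarrow> y \<in> snd \<beta>" for y
  proof -
    have "N + c + 1 \<in> two_ended \<alpha> (N + y + c + 1) \<longleftrightarrow> N + c + 1 \<in> two_ended \<beta> (N + y + c + 1)" by (simp add: N)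
    then show ?thesis using assms by (auto simp: two_ended_def subset_iff)
  qed
  ultimately show ?thesis by (auto simp: prod_eq_iff)
qed

text \<open>
  For a long two-ended summand only its lower end matters. Together with \<open>reflect_two_ended\<close> this
  reduces sums of two-ended sets to \<open>two_ended_plus\<close>.
\<close>

lemma plus_two_ended_eq:
  assumes "{c<..} \<subseteq> P" "{c<..} \<subseteq> snd \<beta>" "0 \<in> fst \<beta>" "m \<ge> 2 * c + 1"
  shows "P + two_ended \<beta> m = P + fst \<beta>"
proof (intro equalityI subsetI)
  show "y \<in> P + fst \<beta>" if "y \<in> P + two_ended \<beta> m" for y
    using that set_plus_mono2[of P P "two_ended \<beta> m" "fst \<beta>"] by (auto simp: two_ended_def)
next
  fix y assume "y \<in> P + fst \<beta>"
  then obtain x b where y: "y = x + b" "x \<in> P" "b \<in> fst \<beta>" by (rule set_plus_elim)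
  show "y \<in> P + two_ended \<beta> m"
  proof (cases "b + c < m")
    case True
    then have "b \<in> two_ended \<beta> m" using y assms(2) by (auto simp: two_ended_def)
    then show ?thesis using y by blast
  next
    case False
    \<comment> \<open>A summand near m is so large that the sum lies in P anyway.\<close>
    then have "y \<in> P" using y assms(1,4) by auto
    moreover have "0 \<in> two_ended \<beta> m" using assms by (auto simp: two_ended_def)
    ultimately have "y + 0 \<in> P + two_ended \<beta> m" by (rule set_plus_intro)
    then show ?thesis by simp
  qed
qed

lemma reflect_two_ended: "(\<lambda>b. m - b) ` two_ended \<beta> m = two_ended (prod.swap \<beta>) m"
  by (auto simp: two_ended_def image_iff) (metis diff_diff_cancel diff_le_self)

text \<open>
  The action of \<open>f\<close> on the pairs of ends. Such a pair exists for automorphisms by \<open>image_two_ended\<close>,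
  and it is unique by \<open>cofin0_pair_eqI\<close>.
\<close>

definition induced :: "nat set \<Rightarrow> (nat set \<Rightarrow> nat set) \<Rightarrow> nat set \<times> nat set \<Rightarrow> nat set \<times> nat set" where
  "induced H f \<alpha> = (SOME \<beta>. \<beta> \<in> cofin0 H \<times> cofin0 UNIV \<and>
     (\<forall>\<^sub>F n in sequentially. f (two_ended \<alpha> n) = two_ended \<beta> n))"

lemma pair_bound:
  assumes "\<alpha> \<in> cofin0 H \<times> cofin0 UNIV"
  obtains c where "\<And>d. d \<ge> c \<Longrightarrow> {d<..} \<subseteq> fst \<alpha>" "\<And>d. d \<ge> c \<Longrightarrow> {d<..} \<subseteq> snd \<alpha>"
proof -
  have "finite (UNIV - fst \<alpha>)" "finite (UNIV - snd \<alpha>)"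
    using assms by (auto simp: cofin0_def mem_Times_iff)
  then obtain c1 c2 where "{c1<..} \<subseteq> fst \<alpha>" "{c2<..} \<subseteq> snd \<alpha>"
    using finite_compl_bounded by metis
  then show ?thesis using that[of "max c1 c2"] by fastforce
qed

lemma cofin0_pair_eqI:
  assumes "\<alpha> \<in> cofin0 H \<times> cofin0 UNIV" "\<beta> \<in> cofin0 H \<times> cofin0 UNIV"
    and "\<forall>\<^sub>F n in sequentially. two_ended \<alpha> n = two_ended \<beta> n"
  shows "\<alpha> = \<beta>"
proof -
  obtain a b where ab: "\<And>d. d \<ge> a \<Longrightarrow> {d<..} \<subseteq> fst \<alpha>" "\<And>d. d \<ge> a \<Longrightarrow> {d<..} \<subseteq> snd \<alpha>"
    "\<And>d. d \<ge> b \<Longrightarrow> {d<..} \<subseteq> fst \<beta>" "\<And>d. d \<ge> b \<Longrightarrow> {d<..} \<subseteq> snd \<beta>"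
    using pair_bound[OF assms(1)] pair_bound[OF assms(2)] by metis
  show ?thesis
    using ab[of "max a b"] assms(3) by (intro two_ended_eventually_inject[of "max a b"]) auto
qed

lemma two_ended_in_fin0:
  assumes "\<alpha> \<in> cofin0 H \<times> cofin0 UNIV" "{c<..} \<subseteq> fst \<alpha>" "{c<..} \<subseteq> snd \<alpha>" "n > c"
  shows "two_ended \<alpha> n \<in> fin0 H" "Max (two_ended \<alpha> n) = n"
proof -
  have "finite (two_ended \<alpha> n)" by (rule finite_subset[of _ "{..n}"]) (auto simp: two_ended_def)
  moreover have "n \<in> fst \<alpha>" "n \<in> snd \<alpha>" using assms by auto
  ultimately show "two_ended \<alpha> n \<in> fin0 H" "Max (two_ended \<alpha> n) = n"
    using assms(1) by (auto simp: fin0_def two_ended_def cofin0_def mem_Times_iff intro!: Max_eqI)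
qed

lemma eventually_two_ended_in_fin0:
  assumes "\<alpha> \<in> cofin0 H \<times> cofin0 UNIV"
  shows "\<forall>\<^sub>F n in sequentially. two_ended \<alpha> n \<in> fin0 H \<and> Max (two_ended \<alpha> n) = n"
proof -
  obtain c where "\<And>d. d \<ge> c \<Longrightarrow> {d<..} \<subseteq> fst \<alpha>" "\<And>d. d \<ge> c \<Longrightarrow> {d<..} \<subseteq> snd \<alpha>"
    using pair_bound[OF assms] by blast
  then have "\<forall>n\<ge>Suc c. two_ended \<alpha> n \<in> fin0 H \<and> Max (two_ended \<alpha> n) = n"
    using two_ended_in_fin0[OF assms, of c] by simp
  then show ?thesis unfolding eventually_sequentially by blast
qed

lemma reflect_in: "X \<in> fin0 H \<Longrightarrow> 0 \<in> (\<lambda>b. Max X - b) ` X"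
  using fin0D(5) by force

lemma pair_plus_in_cofin0:
  assumes "numerical_monoid H" "\<alpha> \<in> cofin0 H \<times> cofin0 UNIV" "A \<in> fin0 H"
  shows "\<alpha> + (A, (\<lambda>b. Max A - b) ` A) \<in> cofin0 H \<times> cofin0 UNIV"
  using assms fin0D[OF assms(3)] reflect_in[OF assms(3)]
  by (auto simp: plus_prod_def mem_Times_iff intro!: plus_in_cofin0 numerical_monoid_UNIV)

context pfin0_automorphism
begin

text \<open>
  Write \<open>X n\<close> for the image of \<open>two_ended \<alpha> n\<close>, and let \<open>c\<close> bound the gaps in \<open>\<alpha>\<close>. For \<open>x > c\<close> and
  large \<open>n\<close> the sumset of \<open>two_ended \<alpha> n\<close> with \<open>{0, x}\<close> is \<open>two_ended \<alpha> (n + x)\<close>, and so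
  \<open>X n + {0, x} = X (n + x)\<close>. These relations imply that \<open>X n\<close> contains all numbers between \<open>c\<close> and
  \<open>n - c\<close>, and that neither of the two ends of \<open>X n\<close> depends on \<open>n\<close>.
\<close>

lemma image_two_ended:
  assumes \<alpha>: "\<alpha> \<in> cofin0 H \<times> cofin0 UNIV"
  shows "\<exists>\<beta>. \<beta> \<in> cofin0 H \<times> cofin0 UNIV \<and> (\<forall>\<^sub>F n in sequentially. f (two_ended \<alpha> n) = two_ended \<beta> n)"
proof -
  obtain P Q where PQ: "\<alpha> = (P, Q)" by (cases \<alpha>)
  obtain c where "\<And>d. d \<ge> c \<Longrightarrow> {d<..} \<subseteq> fst \<alpha>" "\<And>d. d \<ge> c \<Longrightarrow> {d<..} \<subseteq> snd \<alpha>"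
    using pair_bound[OF \<alpha>] by blast
  then have c: "{c<..} \<subseteq> P" "{c<..} \<subseteq> Q" using PQ by auto
  have PH: "P \<subseteq> H" using \<alpha> PQ by (auto simp: cofin0_def)
  define X where "X n = f (two_ended \<alpha> n)" for n
  have in_fin0: "two_ended \<alpha> n \<in> fin0 H" "Max (two_ended \<alpha> n) = n" if "n > c" for n
    using two_ended_in_fin0[OF \<alpha> _ _ that] c PQ by auto
  have X: "0 \<in> X n" "n \<in> X n" "X n \<subseteq> {..n}" "X n \<subseteq> H" if "n > c" for n
    using fin0D[OF f_in[OF in_fin0(1)[OF that]]] Max_image[OF in_fin0(1)[OF that]] in_fin0(2)[OF that]
    by (auto simp: X_def)
  have absorb_pair: "R + {0, x} = R" if "{c<..} \<subseteq> R" "c < x" for R x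
    using that by (auto simp: set_plus_def)
  have A_shift: "two_ended \<alpha> n + {0, x} = two_ended \<alpha> (n + x)" if "c < x" "2 * c + x + 1 \<le> n" for n x
    using two_ended_plus[OF c, of "{0, x}" x n] that absorb_pair[OF c(1) that(1)]
      absorb_pair[OF c(2) that(1)] by (simp add: PQ insert_commute)
  have X_shift: "X n + {0, x} = X (n + x)" if "c < x" "2 * c + x + 1 \<le> n" for n x
  proof -
    have xH: "x \<in> H" using that c PH by auto
    have "X (n + x) = f (two_ended \<alpha> n + {0, x})" using A_shift[OF that] by (simp add: X_def)
    also have "\<dots> = X n + {0, x}"
      using in_fin0(1)[of n] that xH by (simp add: f_add pair_in_fin0 num image_pair X_def)
    finally show ?thesis by simp
  qed
  have X_shift2: "X n + {0, x} + {0, y} = X n + {0, x + y}"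
    if "c < x" "c < y" "2 * c + x + y + 1 \<le> n" for n x y
  proof -
    have "X n + {0, x} + {0, y} = X (n + x + y)"
      using that X_shift[of x n] X_shift[of y "n + x"] by simp
    also have "\<dots> = X n + {0, x + y}" using that X_shift[of "x + y" n] by (simp add: add.assoc)
    finally show ?thesis .
  qed
  \<comment> \<open>The relation between the shifts by x, y and x + y forces a full middle part.\<close>
  have middle: "z \<in> X n" if "6 * c + 6 \<le> n" "c < z" "z + c < n" for n z
  proof (cases "z + 3 * c + 2 \<le> n")
    case True
    \<comment> \<open>The shift by z moves 0 to z, which the shift by z + (c + 1) cannot reach.\<close>
    have "0 + z + 0 \<in> X n + {0, z} + {0, c + 1}" using X(1)[of n] that by (intro set_plus_intro) auto
    then have "z \<in> X n + {0, z + (c + 1)}" using X_shift2[of z "c + 1" n] that True by simp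
    then show ?thesis by (auto simp: set_plus_def)
  next
    case False
    \<comment> \<open>Symmetrically, n + (c + 1) can only come from z by the shift by (c + 1) + (n - z).\<close>
    have "n + (c + 1) + 0 \<in> X n + {0, c + 1} + {0, n - z}"
      using X(2)[of n] that by (intro set_plus_intro) auto
    then have "n + (c + 1) \<in> X n + {0, (c + 1) + (n - z)}"
      using X_shift2[of "c + 1" "n - z" n] that False by simp
    then obtain u where "u \<in> X n" "n + (c + 1) = u \<or> n + (c + 1) = u + ((c + 1) + (n - z))"
      by (auto simp: set_plus_def)
    moreover have "u \<le> n" using X(3)[of n] that \<open>u \<in> X n\<close> by auto
    ultimately have "u = z" using that by auto
    then show ?thesis using \<open>u \<in> X n\<close> by simp
  qed
  have bottom_shift: "z \<in> X (n + x) \<longleftrightarrow> z \<in> X n" if "z \<le> c" "c < x" "2 * c + x + 1 \<le> n" for n x z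
  proof -
    have "X (n + x) = X n \<union> (\<lambda>u. u + x) ` X n"
      using X_shift[OF that(2,3)] by (auto simp: set_plus_def)
    then show ?thesis using that by auto
  qed
  have top_shift: "n + x - z \<in> X (n + x) \<longleftrightarrow> n - z \<in> X n"
    if "z \<le> c" "c < x" "2 * c + x + 1 \<le> n" for n x z
  proof -
    have "X (n + x) = X n \<union> (\<lambda>u. u + x) ` X n"
      using X_shift[OF that(2,3)] by (auto simp: set_plus_def)
    moreover have "n + x - z \<notin> X n" using X(3)[of n] that by auto
    moreover have "n + x - z \<in> (\<lambda>u. u + x) ` X n \<longleftrightarrow> n - z \<in> X n"
    proof -
      have eq: "n + x - z = (n - z) + x" using that by simp
      show ?thesis unfolding eq by auto
    qed
    ultimately show ?thesis by simp
  qed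
  define N where "N = 6 * c + 6"
  have bottom: "z \<in> X n \<longleftrightarrow> z \<in> X N" if "z \<le> c" "N \<le> n" for n z
    using that(2)
  proof (induction n rule: dec_induct)
    case (step n)
    have "z \<in> X (Suc n) \<longleftrightarrow> z \<in> X (Suc n + (c + 1))"
      using bottom_shift[of z "c + 1" "Suc n"] that step by (simp add: N_def)
    also have "\<dots> \<longleftrightarrow> z \<in> X (n + (c + 2))" by simp
    also have "\<dots> \<longleftrightarrow> z \<in> X n"
      using bottom_shift[of z "c + 2" n] that step by (simp add: N_def)
    finally show ?case using step by simp
  qed simp
  have top: "n - z \<in> X n \<longleftrightarrow> N - z \<in> X N" if "z \<le> c" "N \<le> n" for n z
    using that(2)
  proof (induction n rule: dec_induct)
    case (step n)
    have "Suc n - z \<in> X (Suc n) \<longleftrightarrow> Suc n + (c + 1) - z \<in> X (Suc n + (c + 1))"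
      using top_shift[of z "c + 1" "Suc n"] that step by (simp add: N_def)
    also have "\<dots> \<longleftrightarrow> n + (c + 2) - z \<in> X (n + (c + 2))" by simp
    also have "\<dots> \<longleftrightarrow> n - z \<in> X n"
      using top_shift[of z "c + 2" n] that step by (simp add: N_def)
    finally show ?case using step by simp
  qed simp
  define P' where "P' = (X N \<inter> {..c}) \<union> {c<..}"
  define Q' where "Q' = {y. y \<le> c \<and> N - y \<in> X N} \<union> {c<..}"
  have "X n = two_ended (P', Q') n" if n: "N \<le> n" for n
  proof (rule Set.set_eqI)
    fix z
    show "z \<in> X n \<longleftrightarrow> z \<in> two_ended (P', Q') n"
    proof (cases "z \<le> n")
      case False
      then show ?thesis using X(3)[of n] n by (auto simp: two_ended_def N_def)
    next
      case True
      consider "z \<le> c" | "n - z \<le> c" | "c < z" "z + c < n" using True by linarith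
      then show ?thesis
      proof cases
        case 1
        then show ?thesis using bottom[OF 1 n] n by (auto simp: two_ended_def P'_def Q'_def N_def)
      next
        case 2
        then show ?thesis using top[OF 2 n] n True by (auto simp: two_ended_def P'_def Q'_def N_def)
      next
        case 3
        then show ?thesis using middle[of n z] n by (auto simp: two_ended_def P'_def Q'_def N_def)
      qed
    qed
  qed
  then have "\<forall>\<^sub>F n in sequentially. f (two_ended \<alpha> n) = two_ended (P', Q') n"
    unfolding X_def eventually_sequentially by blast
  moreover have "P' \<in> cofin0 H"
    using X(1,4)[of N] c PH finite_compl_greaterThan[of c P']
    by (auto simp: cofin0_def P'_def N_def)
  moreover have "Q' \<in> cofin0 UNIV"
    using X(2)[of N] finite_compl_greaterThan[of c Q'] by (auto simp: cofin0_def Q'_def N_def)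
  ultimately show ?thesis by blast
qed

abbreviation "F \<equiv> induced H f"

lemma
  assumes "\<alpha> \<in> cofin0 H \<times> cofin0 UNIV"
  shows F_in: "F \<alpha> \<in> cofin0 H \<times> cofin0 UNIV"
    and F_eventually: "\<forall>\<^sub>F n in sequentially. f (two_ended \<alpha> n) = two_ended (F \<alpha>) n"
  using someI_ex[OF image_two_ended[OF assms]] by (simp_all add: induced_def)

lemma F_eqI:
  assumes "\<alpha> \<in> cofin0 H \<times> cofin0 UNIV" "\<beta> \<in> cofin0 H \<times> cofin0 UNIV"
    and "\<forall>\<^sub>F n in sequentially. f (two_ended \<alpha> n) = two_ended \<beta> n"
  shows "F \<alpha> = \<beta>"
proof (rule cofin0_pair_eqI[OF F_in[OF assms(1)] assms(2)])
  show "\<forall>\<^sub>F n in sequentially. two_ended (F \<alpha>) n = two_ended \<beta> n"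
    using F_eventually[OF assms(1)] assms(3) by eventually_elim simp
qed

lemma eventually_two_ended_plus:
  assumes "\<alpha> \<in> cofin0 H \<times> cofin0 UNIV" "A \<subseteq> {..a}"
  shows "\<forall>\<^sub>F n in sequentially. two_ended \<alpha> n + A = two_ended (\<alpha> + (A, (\<lambda>b. a - b) ` A)) (n + a)"
proof -
  obtain c where "\<And>d. d \<ge> c \<Longrightarrow> {d<..} \<subseteq> fst \<alpha>" "\<And>d. d \<ge> c \<Longrightarrow> {d<..} \<subseteq> snd \<alpha>"
    using pair_bound[OF assms(1)] by blast
  then have "two_ended \<alpha> n + A = two_ended (\<alpha> + (A, (\<lambda>b. a - b) ` A)) (n + a)" if "n \<ge> 2 * c + a + 1" for n
    using two_ended_plus[of c "fst \<alpha>" "snd \<alpha>" A a n] that assms(2) by (simp add: plus_prod_def)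
  then show ?thesis unfolding eventually_sequentially by blast
qed

text \<open>
  The map \<open>F\<close> is compatible with adding arbitrary sets, not just two-ended ones. This makes \<open>F\<close>
  additive, and it is also how information on \<open>F\<close> is transferred back to \<open>f\<close>.
\<close>

lemma F_act:
  assumes \<alpha>: "\<alpha> \<in> cofin0 H \<times> cofin0 UNIV" and A: "A \<in> fin0 H"
  shows "F (\<alpha> + (A, (\<lambda>b. Max A - b) ` A)) = F \<alpha> + (f A, (\<lambda>b. Max A - b) ` f A)"
proof (rule F_eqI)
  let ?a = "Max A" and ?\<beta> = "\<alpha> + (A, (\<lambda>b. Max A - b) ` A)"
  let ?\<gamma> = "F \<alpha> + (f A, (\<lambda>b. Max A - b) ` f A)"
  show "?\<beta> \<in> cofin0 H \<times> cofin0 UNIV" using pair_plus_in_cofin0 num \<alpha> A .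
  show "?\<gamma> \<in> cofin0 H \<times> cofin0 UNIV"
    using pair_plus_in_cofin0[OF num F_in[OF \<alpha>] f_in[OF A]] Max_image[OF A] by simp
  have sub: "A \<subseteq> {..?a}" "f A \<subseteq> {..?a}"
    using fin0D(6)[OF A] fin0D(6)[OF f_in[OF A]] Max_image[OF A] by auto
  have "\<forall>\<^sub>F n in sequentially. f (two_ended ?\<beta> (n + ?a)) = two_ended ?\<gamma> (n + ?a)"
    using eventually_two_ended_in_fin0[OF \<alpha>] F_eventually[OF \<alpha>]
      eventually_two_ended_plus[OF \<alpha> sub(1)] eventually_two_ended_plus[OF F_in[OF \<alpha>] sub(2)]
  proof eventually_elim
    case (elim n)
    have "f (two_ended ?\<beta> (n + ?a)) = f (two_ended \<alpha> n + A)" by (simp only: elim(3))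
    also have "\<dots> = two_ended (F \<alpha>) n + f A" using elim(1,2) A by (simp add: f_add)
    also have "\<dots> = two_ended ?\<gamma> (n + ?a)" by (rule elim(4))
    finally show ?case .
  qed
  then show "\<forall>\<^sub>F n in sequentially. f (two_ended ?\<beta> n) = two_ended ?\<gamma> n"
    using eventually_sequentially_seg[of "\<lambda>n. f (two_ended ?\<beta> n) = two_ended ?\<gamma> n" ?a] by simp
qed

lemma F_add:
  assumes \<alpha>: "\<alpha> \<in> cofin0 H \<times> cofin0 UNIV" and \<beta>: "\<beta> \<in> cofin0 H \<times> cofin0 UNIV"
  shows "F (\<alpha> + \<beta>) = F \<alpha> + F \<beta>"
proof -
  \<comment> \<open>The set two_ended \<delta> m acts as \<delta> does, so that additivity is a case of F_act.\<close>
  have ev: "\<forall>\<^sub>F m in sequentially. \<gamma> + (two_ended \<delta> m, (\<lambda>b. m - b) ` two_ended \<delta> m) = \<gamma> + \<delta>"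
    if \<gamma>: "\<gamma> \<in> cofin0 H \<times> cofin0 UNIV" and \<delta>: "\<delta> \<in> cofin0 H \<times> cofin0 UNIV" for \<gamma> \<delta>
  proof -
    obtain a b where ab: "\<And>d. d \<ge> a \<Longrightarrow> {d<..} \<subseteq> fst \<gamma>" "\<And>d. d \<ge> a \<Longrightarrow> {d<..} \<subseteq> snd \<gamma>"
      "\<And>d. d \<ge> b \<Longrightarrow> {d<..} \<subseteq> fst \<delta>" "\<And>d. d \<ge> b \<Longrightarrow> {d<..} \<subseteq> snd \<delta>"
      using pair_bound[OF \<gamma>] pair_bound[OF \<delta>] by metis
    have z: "0 \<in> fst \<delta>" "0 \<in> snd \<delta>" using \<delta> by (auto simp: cofin0_def mem_Times_iff)
    have "\<gamma> + (two_ended \<delta> m, (\<lambda>b. m - b) ` two_ended \<delta> m) = \<gamma> + \<delta>" if "m \<ge> 2 * max a b + 1" for m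
      using plus_two_ended_eq[of "max a b" "fst \<gamma>" \<delta> m] that ab[of "max a b"] z
        plus_two_ended_eq[of "max a b" "snd \<gamma>" "prod.swap \<delta>" m]
      by (simp add: plus_prod_def reflect_two_ended)
    then show ?thesis unfolding eventually_sequentially by blast
  qed
  have "\<forall>\<^sub>F m in sequentially. F (\<alpha> + \<beta>) = F \<alpha> + F \<beta>"
    using ev[OF \<alpha> \<beta>] ev[OF F_in[OF \<alpha>] F_in[OF \<beta>]] F_eventually[OF \<beta>] eventually_two_ended_in_fin0[OF \<beta>]
  proof eventually_elim
    case (elim m)
    then show ?case using F_act[OF \<alpha>, of "two_ended \<beta> m"] by simp
  qed
  then show ?thesis by simp
qed

lemma F_inverse:
  assumes "\<alpha> \<in> cofin0 H \<times> cofin0 UNIV" and "pfin0_automorphism H g"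
    and "\<And>X. X \<in> fin0 H \<Longrightarrow> g (f X) = X"
  shows "induced H g (F \<alpha>) = \<alpha>"
proof (rule pfin0_automorphism.F_eqI[OF assms(2) F_in[OF assms(1)] assms(1)])
  show "\<forall>\<^sub>F n in sequentially. g (two_ended (F \<alpha>) n) = two_ended \<alpha> n"
    using F_eventually[OF assms(1)] eventually_two_ended_in_fin0[OF assms(1)]
  proof eventually_elim
    case (elim n)
    then show ?case using assms(3)[of "two_ended \<alpha> n"] by simp
  qed
qed

lemma F_bij: "bij_betw F (cofin0 H \<times> cofin0 UNIV) (cofin0 H \<times> cofin0 UNIV)"
proof -
  let ?g = "inv_into (fin0 H) f"
  interpret inv: pfin0_automorphism H ?g by (rule inverse_aut)
  have gf: "?g (f X) = X" and fg: "f (?g X) = X" if "X \<in> fin0 H" for X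
    using that f_bij by (auto simp: bij_betw_def f_inv_into_f)
  show ?thesis
  proof (rule bij_betw_byWitness[where f' = "induced H ?g"])
    show "\<forall>\<alpha>\<in>cofin0 H \<times> cofin0 UNIV. induced H ?g (F \<alpha>) = \<alpha>"
      using F_inverse[OF _ inverse_aut gf] by blast
    show "\<forall>\<alpha>\<in>cofin0 H \<times> cofin0 UNIV. F (induced H ?g \<alpha>) = \<alpha>"
      using inv.F_inverse[OF _ pfin0_automorphism_axioms fg] by blast
    show "F ` (cofin0 H \<times> cofin0 UNIV) \<subseteq> cofin0 H \<times> cofin0 UNIV"
      using F_in by blast
    show "induced H ?g ` (cofin0 H \<times> cofin0 UNIV) \<subseteq> cofin0 H \<times> cofin0 UNIV"
      using inv.F_in by blast
  qed
qed

section \<open>Automorphisms that respect the two ends\<close>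

sublocale F: bijective_pair_hom H UNIV H UNIV F
  by unfold_locales (simp_all add: num numerical_monoid_UNIV F_bij F_add)

lemma F_pair:
  assumes "\<alpha> \<in> cofin0 H \<times> cofin0 UNIV" "h \<in> H"
  shows "F (\<alpha> + ({0, h}, {0, h})) = F \<alpha> + ({0, h}, {0, h})"
proof -
  have "(\<lambda>b. Max {0, h} - b) ` {0, h} = {0, h}" by auto
  then show ?thesis
    using F_act[OF assms(1), of "{0, h}"] assms(2) by (simp add: pair_in_fin0 num image_pair)
qed

text \<open>
  Let \<open>g\<close> be the largest element of \<open>H\<close> missing in \<open>P\<close>, and \<open>(P', \<nat>)\<close> the image of \<open>(P, \<nat>)\<close>. The sumset
  \<open>P + {0, g}\<close> has fewer gaps, hence is fixed, and it determines \<open>P\<close> below \<open>g\<close>. Every \<open>x > g\<close> in \<open>H\<close>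
  satisfies \<open>P + {0, x} = P\<close>, hence \<open>P' + {0, x} = P'\<close>, and lies in \<open>P'\<close>. So \<open>P'\<close> is \<open>P\<close>
  or \<open>P \<union> {g}\<close>, but the latter has fewer gaps and is itself fixed.
\<close>

lemma F_fix_axis:
  assumes snd: "\<And>P. P \<in> cofin0 H \<Longrightarrow> snd (F (P, UNIV)) = UNIV"
    and P: "P \<in> cofin0 H"
  shows "F (P, UNIV) = (P, UNIV)"
  using P
proof (induction "card (H - P)" arbitrary: P rule: less_induct)
  case less
  have UN: "UNIV \<in> cofin0 UNIV" by (simp add: cofin0_def)
  have P: "P \<subseteq> H" "0 \<in> P" using less.prems by (auto simp: cofin0_def)
  have fin: "finite (H - P)" using less.prems by (auto simp: cofin0_def intro: finite_subset[of _ "UNIV - P"])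
  show ?case
  proof (cases "P = H")
    case True
    then show ?thesis using F.F_zero by simp
  next
    case False
    define g where "g = Max (H - P)"
    have g: "g \<in> H" "g \<notin> P" and le_g: "\<And>x. x \<in> H \<Longrightarrow> x \<notin> P \<Longrightarrow> x \<le> g"
      using False P Max_in[OF fin] fin by (auto simp: g_def)
    obtain P' where P': "F (P, UNIV) = (P', UNIV)"
      using snd[OF less.prems] by (metis surjective_pairing)
    have P'_in: "P' \<in> cofin0 H" using F_in[of "(P, UNIV)"] less.prems UN P' by auto
    have U: "UNIV + {0, x} = (UNIV :: nat set)" for x by (auto simp: set_plus_def)
    have shift: "F (P + {0, x}, UNIV) = (P' + {0, x}, UNIV)" if "x \<in> H" for x
      using F_pair[of "(P, UNIV)" x] less.prems that UN P' by (simp add: plus_prod_def U)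
    have "P + {0, g} = P' + {0, g}"
    proof -
      have in_cof: "P + {0, g} \<in> cofin0 H"
        using g zero_H less.prems num by (intro plus_in_cofin0) auto
      have "0 + g \<in> P + {0, g}" using P by (intro set_plus_intro) auto
      moreover have "P \<subseteq> P + {0, g}" by (metis add.commute insertI1 set_zero_plus2)
      ultimately have "P \<subset> P + {0, g}" using g by auto
      then have "H - (P + {0, g}) \<subset> H - P" using in_cof by (auto simp: cofin0_def)
      then have "card (H - (P + {0, g})) < card (H - P)" using fin by (rule psubset_card_mono[rotated])
      then show ?thesis using less.hyps[OF _ in_cof] shift[OF g(1)] by simp
    qed
    then have below: "x \<in> P \<longleftrightarrow> x \<in> P'" if "x < g" for x
        using that by (auto simp: set_plus_def set_eq_iff)
    have above: "x \<in> P'" if "x \<in> H" "g < x" for x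
    proof -
      have "P + {0, x} = P"
        using le_g[of "_ + x"] that P add_H by (fastforce simp: set_plus_def)
      then have "P' + {0, x} = P'" using shift[OF that(1)] P' by simp
      moreover have "0 + x \<in> P' + {0, x}" using P'_in by (intro set_plus_intro) (auto simp: cofin0_def)
      ultimately show ?thesis by simp
    qed
    have "P' = P \<or> P' = insert g P"
    proof -
      have "x \<in> P' - {g} \<longleftrightarrow> x \<in> P" for x
        using g below[of x] above[of x] le_g[of x] P P'_in
        by (cases x g rule: linorder_cases) (auto simp: cofin0_def)
      then have "P' - {g} = P" by blast
      then show ?thesis by auto
    qed
    then show ?thesis
    proof
      assume eq: "P' = insert g P"
      have "H - P' \<subset> H - P" using eq g by auto
      then have "card (H - P') < card (H - P)" using fin by (rule psubset_card_mono[rotated])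
      then have "F (P', UNIV) = F (P, UNIV)" using less.hyps[OF _ P'_in] P' by simp
      then have "P' = P" using F.F_inj[of "(P', UNIV)" "(P, UNIV)"] P'_in less.prems UN by auto
      then show ?thesis using eq g by auto
    qed (use P' in simp)
  qed
qed

text \<open>
  Adding \<open>tail H y\<close> to \<open>A\<close> gives a cofinite set that contains \<open>y\<close> if and only if \<open>A\<close> does. Since \<open>F\<close>
  fixes the resulting pair, \<open>y \<in> f(A)\<close> implies \<open>y \<in> A\<close>.
\<close>

lemma identity_of_axis:
  assumes snd: "\<And>P. P \<in> cofin0 H \<Longrightarrow> snd (F (P, UNIV)) = UNIV"
    and A: "A \<in> fin0 H"
  shows "f A = A"
proof -
  have UN: "UNIV \<in> cofin0 UNIV" by (simp add: cofin0_def)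
  have sub: "f A \<subseteq> A" if A: "A \<in> fin0 H" for A
  proof
    fix y assume y: "y \<in> f A"
    have yH: "y \<in> H" using y f_in[OF A] fin0D(2) by blast
    have U: "UNIV + R = UNIV" if "0 \<in> R" for R :: "nat set"
      using absorb(2)[OF numerical_monoid_UNIV _ that] by simp
    have R: "0 \<in> (\<lambda>b. Max A - b) ` A" "0 \<in> (\<lambda>b. Max A - b) ` f A"
      using reflect_in[OF A] reflect_in[OF f_in[OF A]] Max_image[OF A] by auto
    have t: "tail H y \<in> cofin0 H" using num by (rule tail_in_cofin0)
    have tA: "tail H y + A \<in> cofin0 H"
      using num t fin0D(2,3)[OF A] by (rule plus_in_cofin0)
    have "F (tail H y + A, UNIV) = F (tail H y, UNIV) + (f A, (\<lambda>b. Max A - b) ` f A)"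
      using F_act[of "(tail H y, UNIV)" A] t UN A R by (simp add: plus_prod_def U)
    then have "tail H y + A = tail H y + f A"
      using F_fix_axis[OF snd t] F_fix_axis[OF snd tA] R by (simp add: plus_prod_def)
    moreover have "0 + y \<in> tail H y + f A" using y by (intro set_plus_intro) (auto simp: tail_def)
    ultimately have "y \<in> tail H y + A" by simp
    then show "y \<in> A" by (auto simp: tail_def set_plus_def)
  qed
  show ?thesis using A
  proof (induction "card A" arbitrary: A rule: less_induct)
    case less
    show ?case
    proof (rule ccontr)
      assume "f A \<noteq> A"
      then have "f A \<subset> A" using sub[OF less.prems] by auto
      then have "card (f A) < card A" using fin0D(1)[OF less.prems] by (rule psubset_card_mono[rotated])
      then have "f (f A) = f A" using less.hyps f_in less.prems by blast
      then show False using f_inj f_in less.prems \<open>f A \<noteq> A\<close> by blast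
    qed
  qed
qed

text \<open>
  The pairs \<open>{0, x}\<close> are fixed and act on both axes. Suppose that \<open>H \<noteq> \<nat>\<close>. There are \<open>m < p\<close> in \<open>H\<close> such that
  \<open>m\<close> does not divide \<open>p\<close> in \<open>H\<close>; thus \<open>{0, p}\<close> fills the puncture at \<open>p\<close> and \<open>{0, m}\<close> acts trivially
  on it. If the puncture is carried to the upper end, a set \<open>Q \<noteq> \<nat>\<close> arises with
  \<open>Q + {0, p} = \<nat>\<close> and \<open>Q + {0, m} = Q\<close>. By the first equation the least gap of \<open>Q\<close> is at least \<open>p\<close>,
  and so the second one fills it.
\<close>

lemma axis_swap_imp_UNIV:
  assumes fst: "\<And>P. P \<in> cofin0 H \<Longrightarrow> fst (F (P, UNIV)) = H"
  shows "H = UNIV"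
proof (rule ccontr)
  assume "H \<noteq> UNIV"
  then obtain s where s: "s \<notin> H" by auto
  obtain c where c: "{c<..} \<subseteq> H" by (rule conductor)
  define m where "m = c + 1"
  define p where "p = s + m"
  have mp: "m \<in> H" "p \<in> H" "p \<noteq> 0" "0 < m" "m < p"
    using c s zero_H by (auto simp: m_def p_def intro!: gr0I)
  have UN: "UNIV \<in> cofin0 UNIV" by (simp add: cofin0_def)
  have in_cof: "H - {p} \<in> cofin0 H" using punctured_in_cofin0 num mp by blast
  obtain Q where Q: "F (H - {p}, UNIV) = (H, Q)"
    using fst[OF in_cof] by (metis surjective_pairing)
  have Q0: "0 \<in> Q" using F_in[of "(H - {p}, UNIV)"] in_cof UN Q by (auto simp: cofin0_def)
  have "Q \<noteq> UNIV"
    using F.F_inj[of "(H - {p}, UNIV)" "(H, UNIV)"] F.F_zero Q in_cof UN self_in_cofin0[OF num] mp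
    by auto
  have U: "UNIV + {0, x} = (UNIV :: nat set)" for x by (auto simp: set_plus_def)
  have shift: "F ((H - {p}) + {0, x}, UNIV) = (H, Q + {0, x})" if "x \<in> H" for x
    using F_pair[of "(H - {p}, UNIV)" x] in_cof that UN Q zero_H
    by (simp add: plus_prod_def U absorb num)
  have "(H - {p}) + {0, p} = H"
    using punctured_plus_eq_iff[OF num, of "{0, p}" p] mp zero_H by auto
  then have Qp: "Q + {0, p} = UNIV" using shift[of p] F.F_zero mp by simp
  have "(H - {p}) + {0, m} \<noteq> H"
    using punctured_plus_eq_iff[OF num, of "{0, m}" p] mp zero_H s by (auto simp: p_def)
  then have "(H - {p}) + {0, m} = H - {p}"
    using punctured_plus_cases[OF num, of "{0, m}" p] mp zero_H by auto
  then have Qm: "Q + {0, m} = Q" using shift[of m] Q mp by simp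
  define q where "q = (LEAST q. q \<notin> Q)"
  have q: "q \<notin> Q" using \<open>Q \<noteq> UNIV\<close> unfolding q_def by (metis LeastI UNIV_eq_I)
  have q_min: "x \<in> Q" if "x < q" for x using that not_less_Least q_def by blast
  have "q \<in> Q + {0, p}" using Qp by simp
  then have "p \<le> q" using q by (auto simp: set_plus_def)
  then have "q - m \<in> Q" using q_min[of "q - m"] mp by simp
  then have "q - m + m \<in> Q + {0, m}" by (intro set_plus_intro) auto
  then show False using Qm q \<open>p \<le> q\<close> mp by simp
qed

end

section \<open>Reversion and the automorphism group\<close>

lemma reversion_eq: "reversion X = (\<lambda>x. Max X - x) ` X"
  by (auto simp: reversion_def)

lemma reversion_fin0:
  assumes X: "X \<in> fin0 UNIV"
  shows reversion_in_fin0: "reversion X \<in> fin0 UNIV"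
    and Max_reversion: "Max (reversion X) = Max X"
    and reversion_reversion: "reversion (reversion X) = X"
proof -
  note D = fin0D[OF X]
  show 1: "reversion X \<in> fin0 UNIV"
    using D(1) reflect_in[OF X] by (simp add: fin0_def reversion_eq)
  have "Max X \<in> reversion X" using D(3) by (force simp: reversion_eq)
  then show 2: "Max (reversion X) = Max X"
    using fin0D(1)[OF 1] by (intro Max_eqI) (auto simp: reversion_eq)
  have "Max X - (Max X - x) = x" if "x \<in> X" for x using D(6) that by auto
  then have "(\<lambda>x. Max X - (Max X - x)) ` X = X" by simp
  then show "reversion (reversion X) = X"
    using 2 by (simp add: reversion_eq image_image)
qed

lemma reversion_plus:
  assumes "X \<in> fin0 UNIV" "Y \<in> fin0 UNIV"
  shows "reversion (X + Y) = reversion X + reversion Y"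
proof -
  have M: "Max (X + Y) = Max X + Max Y" using assms by (intro Max_set_plus fin0D)
  have le: "x \<le> Max X" "y \<le> Max Y" if "x \<in> X" "y \<in> Y" for x y
    using fin0D(6)[OF assms(1)] fin0D(6)[OF assms(2)] that by auto
  have "Max X + Max Y - (x + y) = (Max X - x) + (Max Y - y)" if "x \<in> X" "y \<in> Y" for x y
    using le[OF that] by simp
  note split = this
  show ?thesis
    unfolding reversion_eq M
  proof (intro equalityI subsetI)
    fix z assume "z \<in> (\<lambda>x. Max X + Max Y - x) ` (X + Y)"
    then obtain x y where "z = Max X + Max Y - (x + y)" "x \<in> X" "y \<in> Y"
      by (auto elim!: set_plus_elim)
    then show "z \<in> (\<lambda>x. Max X - x) ` X + (\<lambda>y. Max Y - y) ` Y"
      using split by auto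
  next
    fix z assume "z \<in> (\<lambda>x. Max X - x) ` X + (\<lambda>y. Max Y - y) ` Y"
    then obtain x y where "z = (Max X - x) + (Max Y - y)" "x \<in> X" "y \<in> Y"
      by (auto elim!: set_plus_elim)
    then show "z \<in> (\<lambda>x. Max X + Max Y - x) ` (X + Y)"
      using split by (intro image_eqI[of _ _ "x + y"]) auto
  qed
qed

lemma pfin0_automorphism_reversion: "pfin0_automorphism UNIV reversion"
proof
  show "bij_betw reversion (fin0 UNIV) (fin0 UNIV)"
    by (rule bij_betw_byWitness[where f' = reversion])
      (auto simp: reversion_in_fin0 reversion_reversion)
qed (simp_all add: numerical_monoid_UNIV reversion_plus)

lemma pfin0_automorphism_comp:
  assumes "pfin0_automorphism H f" "pfin0_automorphism H g"
  shows "pfin0_automorphism H (g \<circ> f)"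
proof -
  interpret f: pfin0_automorphism H f by fact
  interpret g: pfin0_automorphism H g by fact
  show ?thesis
    using bij_betw_trans[OF f.f_bij g.f_bij]
    by unfold_locales (simp_all add: f.num f.f_add g.f_add f.f_in)
qed

lemma reversion_two_ended:
  "Max (two_ended \<alpha> n) = n \<Longrightarrow> reversion (two_ended \<alpha> n) = two_ended (prod.swap \<alpha>) n"
  by (simp add: reversion_eq reflect_two_ended)

text \<open>
  If \<open>F\<close> exchanges the two axes, then the automorphism induced by the composition of \<open>f\<close> with the
  reversion respects them.
\<close>

lemma pfin0_automorphism_cases:
  assumes "pfin0_automorphism H f"
  shows "(\<forall>X\<in>fin0 H. f X = X) \<or> H = UNIV \<and> (\<forall>X\<in>fin0 H. f X = reversion X)"
proof -
  interpret pfin0_automorphism H f by fact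
  have UN: "UNIV \<in> cofin0 UNIV" by (simp add: cofin0_def)
  from F.axis_dichotomy show ?thesis
  proof
    assume "\<forall>P\<in>cofin0 H. snd (F (P, UNIV)) = UNIV"
    then show ?thesis using identity_of_axis by blast
  next
    assume fst: "\<forall>P\<in>cofin0 H. fst (F (P, UNIV)) = H"
    then have H: "H = UNIV" using axis_swap_imp_UNIV by blast
    interpret rf: pfin0_automorphism UNIV "reversion \<circ> f"
      using pfin0_automorphism_comp[OF assms] pfin0_automorphism_reversion H by simp
    have "snd (rf.F (P, UNIV)) = UNIV" if P: "P \<in> cofin0 UNIV" for P
    proof -
      have in_cof: "(P, UNIV) \<in> cofin0 H \<times> cofin0 UNIV" using P UN H by auto
      have "rf.F (P, UNIV) = prod.swap (F (P, UNIV))"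
      proof (rule rf.F_eqI)
        show "prod.swap (F (P, UNIV)) \<in> cofin0 UNIV \<times> cofin0 UNIV"
          using F_in[OF in_cof] H by auto
        show "\<forall>\<^sub>F n in sequentially. (reversion \<circ> f) (two_ended (P, UNIV) n) =
            two_ended (prod.swap (F (P, UNIV))) n"
          using F_eventually[OF in_cof] eventually_two_ended_in_fin0[OF F_in[OF in_cof]]
          by eventually_elim (simp add: reversion_two_ended)
      qed (use in_cof H in simp)
      then show ?thesis using fst P H by simp
    qed
    then have "reversion (f X) = X" if "X \<in> fin0 UNIV" for X
      using rf.identity_of_axis that by simp
    then have "f X = reversion X" if "X \<in> fin0 UNIV" for X
      using that reversion_reversion[of "f X"] f_in[of X] H by simp
    then show ?thesis using H by simp
  qed
qed

lemma carrier_Pfin0: "carrier (Pfin0 H) = fin0 H"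
  by (simp add: Pfin0_def fin0_def)

lemma auto_Pfin0_iff:
  assumes "numerical_monoid H"
  shows "f \<in> auto (Pfin0 H) \<longleftrightarrow> f \<in> extensional (fin0 H) \<and> pfin0_automorphism H f"
proof -
  have m: "monoid.mult (Pfin0 H) = (+)" by (simp add: Pfin0_def)
  show ?thesis
    using assms bij_betwE[of f "fin0 H" "fin0 H"]
    by (auto simp: auto_def Bij_def hom_def carrier_Pfin0 m pfin0_automorphism_def)
qed

lemma pfin0_automorphism_restrict:
  assumes "pfin0_automorphism H f"
  shows "pfin0_automorphism H (restrict f (fin0 H))"
proof -
  interpret pfin0_automorphism H f by fact
  show ?thesis
  proof
    show "bij_betw (restrict f (fin0 H)) (fin0 H) (fin0 H)"
      using f_bij bij_betw_cong[of "fin0 H" "restrict f (fin0 H)" f] by simp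
  qed (simp_all add: num f_add plus_in_fin0)
qed

lemma pfin0_automorphism_id: "numerical_monoid H \<Longrightarrow> pfin0_automorphism H (\<lambda>X. X)"
  by unfold_locales (simp_all add: bij_betw_def)

lemma AutoGroup_sel:
  "carrier (AutoGroup G) = auto G" "one (AutoGroup G) = (\<lambda>X\<in>carrier G. X)"
  "monoid.mult (AutoGroup G) = (\<lambda>g\<in>Bij (carrier G). \<lambda>f\<in>Bij (carrier G). compose (carrier G) g f)"
  by (simp_all add: AutoGroup_def BijGroup_def)

theorem theorem1p2:
  fixes H :: "nat set"
  assumes "numerical_monoid H"
  shows "(H \<noteq> UNIV \<longrightarrow> trivial_group (AutoGroup (Pfin0 H))) \<and>
         (H = UNIV \<longrightarrow> carrier (AutoGroup (Pfin0 H)) - {\<one>\<^bsub>AutoGroup (Pfin0 H)\<^esub>}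
                        = {restrict reversion (carrier (Pfin0 H))})"
proof (intro conjI impI)
  have ext: "f = restrict g (fin0 H)" if "f \<in> extensional (fin0 H)" "\<And>X. X \<in> fin0 H \<Longrightarrow> f X = g X" for f g
    using that by (intro extensionalityI[of f "fin0 H"]) auto
  have one: "(\<lambda>X\<in>fin0 H. X) \<in> auto (Pfin0 H)"
    using pfin0_automorphism_restrict[OF pfin0_automorphism_id] assms by (simp add: auto_Pfin0_iff)
  have cases: "f = (\<lambda>X\<in>fin0 H. X) \<or> H = UNIV \<and> f = restrict reversion (fin0 H)"
    if "f \<in> auto (Pfin0 H)" for f
  proof -
    have f: "f \<in> extensional (fin0 H)" "pfin0_automorphism H f"
      using that assms by (simp_all add: auto_Pfin0_iff)
    show ?thesis
      using pfin0_automorphism_cases[OF f(2)] ext[OF f(1), of "\<lambda>X. X"] ext[OF f(1), of reversion] by auto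
  qed
  {
    assume "H \<noteq> UNIV"
    then have "auto (Pfin0 H) = {\<lambda>X\<in>fin0 H. X}" using one cases by blast
    moreover from this one have "(\<lambda>X\<in>fin0 H. X) \<in> Bij (fin0 H)" by (simp add: id_Bij)
    ultimately show "trivial_group (AutoGroup (Pfin0 H))"
      unfolding trivial_group_def
      by (intro conjI groupI) (auto simp: AutoGroup_sel carrier_Pfin0)
  }
  assume H: "H = UNIV"
  have "restrict reversion (fin0 H) \<in> auto (Pfin0 H)"
    using pfin0_automorphism_restrict[OF pfin0_automorphism_reversion] assms H by (simp add: auto_Pfin0_iff)
  moreover have "restrict reversion (fin0 H) \<noteq> (\<lambda>X\<in>fin0 H. X)"
  proof
    assume "restrict reversion (fin0 H) = (\<lambda>X\<in>fin0 H. X)"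
    \<comment> \<open>No set with a smaller maximum distinguishes the reversion from the identity.\<close>
    moreover have "{0, 1, 3} \<in> fin0 H" by (simp add: H fin0_def)
    ultimately have "reversion {0, 1, 3} = {0, 1, 3}" by (metis restrict_apply')
    moreover have "(2 :: nat) \<in> reversion {0, 1, 3}" by (auto simp: reversion_eq)
    ultimately show False by simp
  qed
  ultimately show "carrier (AutoGroup (Pfin0 H)) - {\<one>\<^bsub>AutoGroup (Pfin0 H)\<^esub>}
      = {restrict reversion (carrier (Pfin0 H))}"
    using cases by (auto simp: AutoGroup_sel carrier_Pfin0)
qed

end
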